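(* Let $C$ be a field of characteristic $p>0$, $D$ a central division algebra over $C$ of degree $n$ (i.e. $[D:C]=n^2$), $\delta$ a derivation of $D$ and $F=\{a\in C : \delta(a)=0\}$. Suppose that $\delta$, as well as its restriction $\delta|_C$, has minimum polynomial $g(t)=t^p-t\in F[t]$ over $F$. Then for every $f(t)=t^p-t-d\in D[t;\delta]$ with $d\in D$, the algebra $(D,\delta,d)=S_f=D[t;\delta]/D[t;\delta]f(t)$ is a (not necessarily associative) algebra over $F$ of dimension $n^2p^2$, and the following are equivalent: (a) $(D,\delta,d)$ is a division algebra; (b) $d\neq V_p(z)-z$ for all $z\in D$; (c) $d\neq t^p-(t-z)^p-z$ (in $D[t;\delta]$) for all $z\in D$. The algebra $(D,\delta,d)$ is associative if and only if $d\in F$. Moreover, ${\rm Aut}_F((D,\delta,d))$ has a cyclic subgroup of order $p$ generated by $G=G_{id,-1}$; in particular $G|_D=id_D$.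
   Context: $D[t;\delta]$ is the differential polynomial ring: polynomials $\sum a_it^i$ with left coefficients $a_i\in D$, termwise addition, and multiplication determined by $ta=at+\delta(a)$ for $a\in D$. It has right division: for all $h,f$ with $f\neq 0$ there are unique $q,r$ with $h=qf+r$ and $\deg r<\deg f$; write $r=h \bmod_r f$. For monic $f\in D[t;\delta]$ of degree $m\ge 2$, the Petit algebra $S_f=D[t;\delta]/D[t;\delta]f$ is the $F$-vector space $\{h\in D[t;\delta] : \deg h<m\}$ with multiplication $h\circ k = hk \bmod_r f$; it is a unital, not necessarily associative $F$-algebra containing $D$ as the constant polynomials. A nonassociative algebra $A\neq0$ is a division algebra if for each $a\neq 0$ left and right multiplication by $a$ are bijective. For $b\in D$, $V_p(b)\in D$ is defined by $(t-b)^p=t^p-V_p(b)$ in $D[t;\delta]$ (the right side is always of this form in characteristic $p$). $G_{id,-1}$ denotes the map $\sum a_it^i\mapsto\sum a_i(t-1)^i$ (on $D[t;\delta]$, and the induced map on $S_f$). *)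

theory Defs
  imports
    "HOL-Algebra.Algebra"
    "HOL-Algebra.Algebraic_Closure_Type"
    "HOL-Computational_Algebra.Polynomial"
begin

text \<open>
  The division ring \<open>D\<close> is a type of class \<open>division_ring\<close>; subfields of \<open>D\<close> are sets in
  \<open>ring_of_type_algebra\<close>, which is \<open>D\<close> viewed as a ring with carrier \<open>UNIV\<close>.
\<close>

definition central_division_algebra :: "'a::division_ring set \<Rightarrow> nat \<Rightarrow> bool" where
  "central_division_algebra C n \<longleftrightarrow>
     subfield C (ring_of_type_algebra :: 'a ring) \<and>
     C = {c. \<forall>x. c * x = x * c} \<and>
     n > 0 \<and>
     ring.dimension (ring_of_type_algebra :: 'a ring) (n\<^sup>2) C UNIV"

definition derivation :: "('a::ring \<Rightarrow> 'a) \<Rightarrow> bool" where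
  "derivation \<delta> \<longleftrightarrow>
     (\<forall>a b. \<delta> (a + b) = \<delta> a + \<delta> b) \<and> (\<forall>a b. \<delta> (a * b) = \<delta> a * b + a * \<delta> b)"

definition poly_at_map :: "'a::ring_1 poly \<Rightarrow> ('a \<Rightarrow> 'a) \<Rightarrow> 'a \<Rightarrow> 'a" where
  "poly_at_map q \<delta> x = (\<Sum>i\<le>degree q. coeff q i * (\<delta> ^^ i) x)"

definition is_minimum_polynomial ::
  "'a::ring_1 set \<Rightarrow> 'a set \<Rightarrow> ('a \<Rightarrow> 'a) \<Rightarrow> 'a poly \<Rightarrow> bool" where
  "is_minimum_polynomial F V \<delta> g \<longleftrightarrow>
     (\<forall>i. coeff g i \<in> F) \<and> lead_coeff g = 1 \<and> (\<forall>x\<in>V. poly_at_map g \<delta> x = 0) \<and>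
     (\<forall>q. q \<noteq> 0 \<and> (\<forall>i. coeff q i \<in> F) \<and> (\<forall>x\<in>V. poly_at_map q \<delta> x = 0)
        \<longrightarrow> degree g \<le> degree q)"

text \<open>
  Elements of \<open>D[t;\<delta>]\<close> are values of type \<open>'a poly\<close>, read with left coefficients. Only the additive
  structure of that type is used. Since \<open>t b = b t + \<delta>(b)\<close>, left multiplication by \<open>t\<close> sends
  \<open>\<Sum> b\<^sub>j t\<^sup>j\<close> to \<open>\<Sum> b\<^sub>j t\<^sup>j\<^sup>+\<^sup>1 + \<Sum> \<delta>(b\<^sub>j) t\<^sup>j\<close>.
\<close>

definition t_times :: "('a::ring_1 \<Rightarrow> 'a) \<Rightarrow> 'a poly \<Rightarrow> 'a poly" where
  "t_times \<delta> g = pCons 0 g + map_poly \<delta> g"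

definition diff_mult :: "('a::ring_1 \<Rightarrow> 'a) \<Rightarrow> 'a poly \<Rightarrow> 'a poly \<Rightarrow> 'a poly" where
  "diff_mult \<delta> f g = (\<Sum>i\<le>degree f. map_poly ((*) (coeff f i)) ((t_times \<delta> ^^ i) g))"

definition diff_poly_ring :: "('a::ring_1 \<Rightarrow> 'a) \<Rightarrow> 'a poly ring" where
  "diff_poly_ring \<delta> =
     \<lparr>carrier = UNIV, monoid.mult = diff_mult \<delta>, one = [:1:], ring.zero = 0, add = (+)\<rparr>"

lemma t_times_const:
  assumes "derivation \<delta>"
  shows "[:0, 1:] \<otimes>\<^bsub>diff_poly_ring \<delta>\<^esub> [:a:] = [:a:] \<otimes>\<^bsub>diff_poly_ring \<delta>\<^esub> [:0, 1:] + [:\<delta> a:]"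
proof -
  have "\<delta> 0 = 0"
    using assms unfolding derivation_def by (metis add_cancel_right_right)
  then show ?thesis
    by (simp add: diff_poly_ring_def diff_mult_def t_times_def map_poly_pCons)
qed

definition mod_right :: "('a::ring_1 \<Rightarrow> 'a) \<Rightarrow> 'a poly \<Rightarrow> 'a poly \<Rightarrow> 'a poly" where
  "mod_right \<delta> h f =
     (THE r. (r = 0 \<or> degree r < degree f) \<and> (\<exists>q. h = q \<otimes>\<^bsub>diff_poly_ring \<delta>\<^esub> f + r))"

text \<open>
  For \<open>deg f \<ge> 1\<close> the condition \<open>degree h < degree f\<close> includes \<open>h = 0\<close>, since \<open>degree 0 = 0\<close>.
  The record is used as a signature only: the multiplication need not be associative.
\<close>

definition petit_algebra ::
  "('a::ring_1 \<Rightarrow> 'a) \<Rightarrow> 'a poly \<Rightarrow> ('a, 'a poly) module" where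
  "petit_algebra \<delta> f =
     \<lparr>carrier = {h. degree h < degree f},
      monoid.mult = (\<lambda>h k. mod_right \<delta> (h \<otimes>\<^bsub>diff_poly_ring \<delta>\<^esub> k) f),
      one = [:1:], ring.zero = 0, add = (+),
      module.smult = (\<lambda>a h. [:a:] \<otimes>\<^bsub>diff_poly_ring \<delta>\<^esub> h)\<rparr>"

locale nonassoc_algebra = module K A for K and A (structure) +
  assumes scalars_field: "field K"
    and m_closed: "\<lbrakk>x \<in> carrier A; y \<in> carrier A\<rbrakk> \<Longrightarrow> x \<otimes> y \<in> carrier A"
    and m_l_distr: "\<lbrakk>x \<in> carrier A; y \<in> carrier A; z \<in> carrier A\<rbrakk> \<Longrightarrow>
           (x \<oplus> y) \<otimes> z = x \<otimes> z \<oplus> y \<otimes> z"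
    and m_r_distr: "\<lbrakk>x \<in> carrier A; y \<in> carrier A; z \<in> carrier A\<rbrakk> \<Longrightarrow>
           z \<otimes> (x \<oplus> y) = z \<otimes> x \<oplus> z \<otimes> y"
    and smult_m_l: "\<lbrakk>k \<in> carrier K; x \<in> carrier A; y \<in> carrier A\<rbrakk> \<Longrightarrow>
           (k \<odot> x) \<otimes> y = k \<odot> (x \<otimes> y)"
    and smult_m_r: "\<lbrakk>k \<in> carrier K; x \<in> carrier A; y \<in> carrier A\<rbrakk> \<Longrightarrow>
           x \<otimes> (k \<odot> y) = k \<odot> (x \<otimes> y)"
    and unit_closed: "\<one> \<in> carrier A"
    and unit_l: "x \<in> carrier A \<Longrightarrow> \<one> \<otimes> x = x"
    and unit_r: "x \<in> carrier A \<Longrightarrow> x \<otimes> \<one> = x"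

definition is_division_algebra :: "('k, 'a, 'b) module_scheme \<Rightarrow> bool" where
  "is_division_algebra A \<longleftrightarrow>
     carrier A \<noteq> {\<zero>\<^bsub>A\<^esub>} \<and>
     (\<forall>a\<in>carrier A - {\<zero>\<^bsub>A\<^esub>}.
        bij_betw (\<lambda>x. a \<otimes>\<^bsub>A\<^esub> x) (carrier A) (carrier A) \<and>
        bij_betw (\<lambda>x. x \<otimes>\<^bsub>A\<^esub> a) (carrier A) (carrier A))"

definition is_associative_algebra :: "('k, 'a, 'b) module_scheme \<Rightarrow> bool" where
  "is_associative_algebra A \<longleftrightarrow>
     (\<forall>x\<in>carrier A. \<forall>y\<in>carrier A. \<forall>z\<in>carrier A.
        (x \<otimes>\<^bsub>A\<^esub> y) \<otimes>\<^bsub>A\<^esub> z = x \<otimes>\<^bsub>A\<^esub> (y \<otimes>\<^bsub>A\<^esub> z))"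

text \<open>As in \<open>BijGroup\<close>, automorphisms are functions that are \<open>undefined\<close> outside \<open>carrier A\<close>.\<close>

definition algebra_auts ::
  "('k, 'c) ring_scheme \<Rightarrow> ('k, 'a, 'b) module_scheme \<Rightarrow> ('a \<Rightarrow> 'a) set" where
  "algebra_auts K A =
     {\<phi> \<in> Bij (carrier A). \<phi> \<in> hom A A \<and> \<phi> \<in> hom (add_monoid A) (add_monoid A) \<and>
        (\<forall>k\<in>carrier K. \<forall>x\<in>carrier A. \<phi> (k \<odot>\<^bsub>A\<^esub> x) = k \<odot>\<^bsub>A\<^esub> \<phi> x)}"

definition algebra_Aut ::
  "('k, 'c) ring_scheme \<Rightarrow> ('k, 'a, 'b) module_scheme \<Rightarrow> ('a \<Rightarrow> 'a) monoid" where
  "algebra_Aut K A = BijGroup (carrier A) \<lparr>carrier := algebra_auts K A\<rparr>"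

definition V_map :: "('a::ring_1 \<Rightarrow> 'a) \<Rightarrow> nat \<Rightarrow> 'a \<Rightarrow> 'a" where
  "V_map \<delta> p b = (THE v. [:- b, 1:] [^]\<^bsub>diff_poly_ring \<delta>\<^esub> p = monom 1 p - [:v:])"

definition G_id_minus1 :: "('a::ring_1 \<Rightarrow> 'a) \<Rightarrow> 'a poly \<Rightarrow> 'a poly" where
  "G_id_minus1 \<delta> h =
     (\<Sum>i\<le>degree h. [:coeff h i:] \<otimes>\<^bsub>diff_poly_ring \<delta>\<^esub> ([:- 1, 1:] [^]\<^bsub>diff_poly_ring \<delta>\<^esub> i))"

text \<open>
  The map induced on the quotient by \<open>D[t;\<delta>]f\<close>, in terms of the representatives of degree
  less than \<open>deg f\<close>.
\<close>

definition G_petit :: "('a::ring_1 \<Rightarrow> 'a) \<Rightarrow> 'a poly \<Rightarrow> 'a poly \<Rightarrow> 'a poly" where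
  "G_petit \<delta> f = (\<lambda>h\<in>carrier (petit_algebra \<delta> f). mod_right \<delta> (G_id_minus1 \<delta> h) f)"

end

theory Submission
  imports Defs "HOL-Number_Theory.Residues"
begin

text \<open>
  Since \<open>t\<^sup>p - t\<close> is the minimum polynomial of \<open>\<delta>\<close> on \<open>C\<close>, its factor \<open>(t\<^sup>p - t) / (t - 1)\<close> does
  not annihilate \<open>C\<close>, which yields \<open>u \<noteq> 0\<close> in \<open>C\<close> with \<open>\<delta>(u) = u\<close>. The powers \<open>1, u, \<dots>, u\<^bsup>p-1\<^esup>\<close> form
  a basis of \<open>C\<close> over \<open>F\<close>, and \<open>u t u\<inverse> = t - 1\<close>, so that \<open>G\<close> is conjugation by \<open>u\<close>. Since
  \<open>t\<^sup>p - t\<close> is central in \<open>D[t;\<delta>]\<close>, this conjugation fixes \<open>f = t\<^sup>p - t - d\<close>.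

  For the division property, let \<open>r\<close> be the least positive degree of a right divisor of \<open>f\<close>. The
  least common left multiple \<open>h\<close> of all monic right divisors of degree \<open>r\<close> divides \<open>f\<close>, its degree is
  a multiple of \<open>r\<close>, and it is fixed by conjugation
    by \<open>u\<close>. Comparing the coefficients of
  \<open>t\<^bsup>deg h - 1\<^esup>\<close> in \<open>h(t - 1) = h(t)\<close> shows that \<open>p\<close> divides \<open>deg h\<close>, hence \<open>deg h = p\<close> and
  \<open>r\<close> is \<open>1\<close> or \<open>p\<close>. So \<open>f\<close> is either irreducible or has a right factor \<open>t - z\<close>, and the latter
  means \<open>d = V\<^sub>p(z) - z\<close>. Zero divisors in \<open>S\<^sub>f\<close> give a proper right divisor of \<open>f\<close> by the Euclidean
  algorithm, and injective \<open>F\<close>-linear maps of \<open>S\<^sub>f\<close> are bijective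
    by finite dimensionality.
\<close>

subsection \<open>Differential polynomial rings over division rings\<close>

lemma coeff_map_poly_times [simp]:
  "coeff (map_poly ((*) a) h) i = a * coeff (h :: 'a::ring_1 poly) i"
  by (simp add: coeff_map_poly)

lemma map_poly_times_one [simp]: "map_poly ((*) 1) h = (h :: 'a::ring_1 poly)"
  by (simp add: poly_eq_iff)

lemma map_poly_times_zero [simp]: "map_poly ((*) 0) h = (0 :: 'a::ring_1 poly)"
  by (simp add: poly_eq_iff)

lemma map_poly_times_times:
  "map_poly ((*) (a * b)) h = map_poly ((*) a) (map_poly ((*) b) (h :: 'a::ring_1 poly))"
  by (simp add: poly_eq_iff mult.assoc)

lemma map_poly_times_add:
  "map_poly ((*) a) (g + h) = map_poly ((*) a) g + map_poly ((*) a) (h :: 'a::ring_1 poly)"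
  by (simp add: poly_eq_iff distrib_left)

lemma map_poly_add_times:
  "map_poly ((*) (a + b)) h = map_poly ((*) a) h + map_poly ((*) b) (h :: 'a::ring_1 poly)"
  by (simp add: poly_eq_iff distrib_right)

section \<open>Derivations and the ring laws of \<open>D[t;\<delta>]\<close>\<close>

locale differential_division_ring =
  fixes \<delta> :: "'a::division_ring \<Rightarrow> 'a"
  assumes derivation: "derivation \<delta>"
begin

abbreviation diff_mult_op (infixl \<open>\<star>\<close> 70) where "f \<star> g \<equiv> diff_mult \<delta> f g"

lemma delta_add: "\<delta> (a + b) = \<delta> a + \<delta> b"
  using derivation by (simp add: derivation_def)

lemma delta_mult: "\<delta> (a * b) = \<delta> a * b + a * \<delta> b"
  using derivation by (simp add: derivation_def)

lemma delta_0 [simp]: "\<delta> 0 = 0"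
  using delta_add [of 0 0] by simp

lemma delta_1 [simp]: "\<delta> 1 = 0"
  using delta_mult [of 1 1] by simp

lemma delta_minus: "\<delta> (- a) = - \<delta> a"
  using delta_add [of a "- a"] by (simp add: eq_neg_iff_add_eq_0 add.commute)

lemma delta_diff: "\<delta> (a - b) = \<delta> a - \<delta> b"
  using delta_add [of a "- b"] by (simp add: delta_minus)

lemma delta_of_nat [simp]: "\<delta> (of_nat n) = 0"
  by (induction n) (simp_all add: delta_add)

lemma delta_sum: "\<delta> (sum h A) = (\<Sum>i\<in>A. \<delta> (h i))"
  by (induction A rule: infinite_finite_induct) (simp_all add: delta_add)

lemma delta_of_nat_mult: "\<delta> (of_nat n * a) = of_nat n * \<delta> a"
  by (simp add: delta_mult)

text \<open>Apply \<open>\<delta>\<close> to \<open>c x = x c\<close>; the terms containing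
  \<open>\<delta> x\<close> cancel. Hence \<open>\<delta>\<close> maps the centre into
  itself.\<close>

lemma delta_central:
  assumes c: "\<And>x. c * x = x * c"
  shows "\<delta> c * x = x * \<delta> c"
proof -
  have "\<delta> c * x + c * \<delta> x = \<delta> x * c + x * \<delta> c"
    using c by (metis delta_mult)
  moreover have "c * \<delta> x = \<delta> x * c" using c by blast
  ultimately show ?thesis by (metis add.commute add_left_cancel)
qed

lemma coeff_t_times:
  "coeff (t_times \<delta> g) i =
      (case i of 0 \<Rightarrow> 0 | Suc j \<Rightarrow> coeff g j) + \<delta> (coeff g i)"
  by (simp add: t_times_def coeff_pCons coeff_map_poly)

lemma t_times_0 [simp]: "t_times \<delta> 0 = 0"
  by (simp add: t_times_def)

lemma t_times_add: "t_times \<delta> (g + h) = t_times \<delta> g + t_times \<delta> h"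
  by (simp add: poly_eq_iff coeff_t_times delta_add split: nat.splits)

lemma t_times_funpow_0 [simp]: "(t_times \<delta> ^^ i) 0 = 0"
  by (induction i) simp_all

lemma t_times_lscale:
  "t_times \<delta> (map_poly ((*) a) g) =
      map_poly ((*) a) (t_times \<delta> g) + map_poly ((*) (\<delta> a)) g"
  by (simp add: poly_eq_iff coeff_t_times delta_mult distrib_left split: nat.splits)

lemma t_times_pCons:
  "t_times \<delta> (pCons a g) = pCons (\<delta> a) (t_times \<delta> g + [:a:])"
  by (simp add: poly_eq_iff coeff_t_times coeff_pCons split: nat.splits)

lemma diff_mult_0_left [simp]: "0 \<star> g = 0"
  by (simp add: diff_mult_def)

lemma diff_mult_0_right [simp]: "f \<star> 0 = 0"
  by (simp add: diff_mult_def)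

text \<open>The recursion (a + f t) g = a g + f (t g) replaces the sum in
  \<open>diff_mult_def\<close>, so that the ring laws follow by induction on the left
  factor.\<close>

lemma diff_mult_pCons: "pCons a f \<star> g = map_poly ((*) a) g + f \<star> t_times \<delta> g"
proof (cases "f = 0")
  case True
  then show ?thesis by (simp add: diff_mult_def)
next
  case False
  then have "pCons a f \<star> g =
      (\<Sum>i\<le>Suc (degree f). map_poly ((*) (coeff (pCons a f) i)) ((t_times \<delta> ^^ i) g))"
    by (simp add: diff_mult_def)
  also have "\<dots> = map_poly ((*) a) g + (\<Sum>i\<le>degree f. map_poly ((*) (coeff f i)) ((t_times \<delta> ^^ Suc i) g))"
    by (subst sum.atMost_Suc_shift) simp
  also have "\<dots> = map_poly ((*) a) g + f \<star> t_times \<delta> g"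
    by (simp add: diff_mult_def funpow_swap1)
  finally show ?thesis .
qed

lemma diff_mult_const [simp]: "[:a:] \<star> g = map_poly ((*) a) g"
  by (simp add: diff_mult_pCons)

lemma diff_mult_t: "[:0, 1:] \<star> g = t_times \<delta> g"
  by (simp add: diff_mult_pCons)

text \<open>Since \<open>pCons 0 g\<close> is g t, this is associativity for the right factor t,
  obtained ahead of the general law.\<close>

lemma diff_mult_pCons_0_right: "f \<star> pCons 0 g = pCons 0 (f \<star> g)"
proof (induction f arbitrary: g)
  case (pCons a f)
  then show ?case by (simp add: diff_mult_pCons t_times_pCons map_poly_pCons)
qed simp

lemma diff_mult_1_right: "f \<star> [:1:] = f"
proof (induction f)
  case (pCons a f)
  have "t_times \<delta> [:1:] = pCons 0 [:1:]"
    by (simp add: t_times_pCons)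
  then show ?case
    using pCons by (simp only: diff_mult_pCons diff_mult_pCons_0_right) (simp add: map_poly_pCons)
qed simp

lemma diff_mult_add_right: "f \<star> (g + h) = f \<star> g + f \<star> h"
  by (induction f arbitrary: g h) (simp_all add: diff_mult_pCons t_times_add map_poly_times_add algebra_simps)

lemma diff_mult_add_left: "(f + g) \<star> h = f \<star> h + g \<star> h"
proof (induction f arbitrary: g h)
  case (pCons a f)
  obtain b g' where g: "g = pCons b g'" by (cases g)
  show ?case by (simp add: g diff_mult_pCons pCons.IH map_poly_add_times algebra_simps)
qed simp

lemma diff_mult_minus_left: "(- f) \<star> g = - (f \<star> g)"
  using diff_mult_add_left [of f "- f" g] by (simp add: eq_neg_iff_add_eq_0 add.commute)

lemma diff_mult_minus_right: "f \<star> (- g) = - (f \<star> g)"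
  using diff_mult_add_right [of f g "- g"] by (simp add: eq_neg_iff_add_eq_0 add.commute)

lemma diff_mult_diff_left: "(f - g) \<star> h = f \<star> h - g \<star> h"
  using diff_mult_add_left [of f "- g" h] by (simp add: diff_mult_minus_left)

lemma diff_mult_diff_right: "f \<star> (g - h) = f \<star> g - f \<star> h"
  using diff_mult_add_right [of f g "- h"] by (simp add: diff_mult_minus_right)

lemma lscale_diff_mult: "map_poly ((*) a) f \<star> g = map_poly ((*) a) (f \<star> g)"
  by (induction f arbitrary: g)
    (simp_all add: diff_mult_pCons map_poly_pCons map_poly_times_add map_poly_times_times)

text \<open>Associativity for the left factor t; the product rule enters through
  \<open>t_times_lscale\<close>. With \<open>lscale_diff_mult\<close> for constant left factors it
  gives \<open>diff_mult_assoc\<close> by the recursion.\<close>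

lemma t_times_diff_mult: "t_times \<delta> f \<star> g = t_times \<delta> (f \<star> g)"
proof (induction f arbitrary: g)
  case (pCons a f)
  show ?case
    by (simp add: t_times_pCons diff_mult_pCons diff_mult_add_left pCons.IH t_times_add t_times_lscale)
qed simp

lemma diff_mult_assoc: "f \<star> g \<star> h = f \<star> (g \<star> h)"
  by (induction f arbitrary: g)
    (simp_all add: diff_mult_pCons diff_mult_add_left lscale_diff_mult t_times_diff_mult)

lemma diff_mult_right_t: "f \<star> [:0, 1:] = pCons 0 f"
  by (simp add: diff_mult_pCons_0_right diff_mult_1_right)

lemma pCons_eq_diff_mult: "pCons a f = [:a:] + f \<star> [:0, 1:]"
  by (simp add: diff_mult_right_t)

lemma ring_diff_poly_ring: "ring (diff_poly_ring \<delta>)"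
proof (rule ringI)
  show "abelian_group (diff_poly_ring \<delta>)"
    by (rule abelian_groupI)
      (auto simp: diff_poly_ring_def algebra_simps intro: exI [of _ "- x" for x])
  show "monoid (diff_poly_ring \<delta>)"
    by (rule monoidI) (auto simp: diff_poly_ring_def diff_mult_assoc diff_mult_1_right)
qed (auto simp: diff_poly_ring_def diff_mult_add_left diff_mult_add_right)

lemma degree_t_times_le: "degree (t_times \<delta> g) \<le> Suc (degree g)"
  by (rule degree_le) (auto simp: coeff_t_times coeff_eq_0 split: nat.splits)

lemma degree_t_times: "g \<noteq> 0 \<Longrightarrow> degree (t_times \<delta> g) = Suc (degree g)"
  using degree_t_times_le [of g] le_degree [of "t_times \<delta> g" "Suc (degree g)"]
  by (auto simp: coeff_t_times coeff_eq_0)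

lemma degree_diff_mult_le: "degree (f \<star> g) \<le> degree f + degree g"
proof (induction f arbitrary: g)
  case (pCons a f)
  have "degree (map_poly ((*) a) g) \<le> degree (pCons a f) + degree g"
    by (rule degree_le) (simp add: coeff_eq_0)
  moreover have "degree (f \<star> t_times \<delta> g) \<le> degree (pCons a f) + degree g"
    using pCons.IH [of "t_times \<delta> g"] degree_t_times_le [of g] by (cases "f = 0") auto
  ultimately show ?case
    by (simp add: diff_mult_pCons degree_add_le)
qed simp

text \<open>Multiplication by t from the left raises the degree by one and keeps the leading
  coefficient, so \<open>\<delta>\<close> disturbs lower coefficients only. As \<open>D\<close> has
  no zero divisors, degrees add and \<open>D[t;\<delta>]\<close> is a domain.\<close>

lemma coeff_diff_mult_degree_add:
  "coeff (f \<star> g) (degree f + degree g) = lead_coeff f * lead_coeff g"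
proof (induction f arbitrary: g)
  case (pCons a f)
  show ?case
  proof (cases "f = 0 \<or> g = 0")
    case False
    have "coeff (f \<star> t_times \<delta> g) (degree f + degree (t_times \<delta> g)) =
        lead_coeff f * lead_coeff g"
      using False by (simp only: pCons.IH) (simp add: degree_t_times coeff_t_times coeff_eq_0)
    with False show ?thesis
      by (simp add: diff_mult_pCons degree_t_times coeff_eq_0)
  qed auto
qed simp

lemma diff_mult_eq_0_iff: "f \<star> g = 0 \<longleftrightarrow> f = 0 \<or> g = 0"
  using coeff_diff_mult_degree_add [of f g] by auto

lemma degree_diff_mult:
  "f \<noteq> 0 \<Longrightarrow> g \<noteq> 0 \<Longrightarrow> degree (f \<star> g) =
      degree f + degree g"
  using degree_diff_mult_le [of f g] coeff_diff_mult_degree_add [of f g]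
  by (metis le_antisym le_degree leading_coeff_0_iff mult_eq_0_iff)

lemma lead_coeff_diff_mult: "lead_coeff (f \<star> g) = lead_coeff f * lead_coeff g"
  using coeff_diff_mult_degree_add [of f g] degree_diff_mult [of f g]
  by (cases "f = 0 \<or> g = 0") auto

section \<open>Right division, right divisors and remainders\<close>

lemma right_division:
  assumes "f \<noteq> 0"
  obtains q r where "h = q \<star> f + r" "r = 0 \<or> degree r < degree f"
proof -
  have "\<exists>q r. h = q \<star> f + r \<and> (r = 0 \<or> degree r < degree f)"
  proof (induction "degree h" arbitrary: h rule: less_induct)
    case less
    show ?case
    proof (cases "h = 0 \<or> degree h < degree f")
      case True
      then show ?thesis by (intro exI [of _ 0] exI [of _ h]) auto
    next
      case False
      \<comment> \<open>The monomial that makes \<open>m \<star> f\<close> agree with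
        \<open>h\<close> in degree and leading coefficient; the inverse stands on the right because
        it must meet \<open>lead_coeff f\<close> there.\<close>
      define m where "m = monom (lead_coeff h * inverse (lead_coeff f)) (degree h - degree f)"
      have m: "m \<noteq> 0" "lead_coeff (m \<star> f) = lead_coeff h"
        using False assms by (simp_all add: m_def lead_coeff_diff_mult degree_monom_eq mult.assoc)
      have deg: "degree (m \<star> f) = degree h"
        using False assms m(1) by (simp add: degree_diff_mult) (simp add: m_def degree_monom_eq)
      show ?thesis
      proof (cases "h - m \<star> f = 0")
        case True
        then show ?thesis by (intro exI [of _ m] exI [of _ 0]) simp
      next
        case nz: False
        have "coeff (h - m \<star> f) (degree h) = 0"
          using m(2) deg by simp
        moreover have "degree (h - m \<star> f) \<le> degree h"
          using degree_diff_le [of h "degree h" "m \<star> f"] deg by simp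
        ultimately have "degree (h - m \<star> f) < degree h"
          using nz by (metis le_neq_implies_less leading_coeff_0_iff)
        then obtain q r where qr: "h - m \<star> f = q \<star> f + r" "r =
            0 \<or> degree r < degree f"
          using less by blast
        have "h = (m + q) \<star> f + r"
          using qr(1) by (simp add: diff_mult_add_left algebra_simps)
        with qr(2) show ?thesis by blast
      qed
    qed
  qed
  then show ?thesis using that by blast
qed

definition right_dvd where "right_dvd c x \<longleftrightarrow> (\<exists>q. x = q \<star> c)"

lemma right_dvdI: "x = q \<star> c \<Longrightarrow> right_dvd c x"
  by (auto simp: right_dvd_def)

lemma right_dvdE: assumes "right_dvd c x" obtains q where "x = q \<star> c"
  using assms by (auto simp: right_dvd_def)

lemma right_dvd_refl: "right_dvd c c"
  by (rule right_dvdI [of _ "[:1:]"]) simp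

lemma right_dvd_0 [simp]: "right_dvd c 0"
  by (rule right_dvdI [of _ 0]) simp

lemma right_dvd_diff_mult: "right_dvd c x \<Longrightarrow> right_dvd c (y \<star> x)"
  by (metis diff_mult_assoc right_dvd_def)

lemma right_dvd_trans:
  "right_dvd c x \<Longrightarrow> right_dvd x y \<Longrightarrow> right_dvd c y"
  by (metis diff_mult_assoc right_dvd_def)

lemma right_dvd_add:
  "right_dvd c x \<Longrightarrow> right_dvd c y \<Longrightarrow> right_dvd c (x + y)"
  by (metis diff_mult_add_left right_dvd_def)

lemma right_dvd_diff:
  "right_dvd c x \<Longrightarrow> right_dvd c y \<Longrightarrow> right_dvd c (x - y)"
  by (metis diff_mult_diff_left right_dvd_def)

lemma right_dvd_degree_le:
  "right_dvd c x \<Longrightarrow> x \<noteq> 0 \<Longrightarrow> degree c \<le> degree x"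
  by (auto simp: right_dvd_def degree_diff_mult diff_mult_eq_0_iff)

lemma right_dvd_imp_eq_0:
  "right_dvd c x \<Longrightarrow> x = 0 \<or> degree x < degree c \<Longrightarrow> x = 0"
  using right_dvd_degree_le by fastforce

text \<open>A nonzero constant on the left does not change the left ideal generated by
  \<open>c\<close>, so right divisors may be taken monic.\<close>

lemma monic_associate:
  assumes "c \<noteq> 0"
  obtains c' where "lead_coeff c' = 1" "degree c' =
      degree c" "\<And>x. right_dvd c' x \<longleftrightarrow> right_dvd c x"
proof -
  define a where "a = lead_coeff c"
  have a: "a \<noteq> 0" using assms by (simp add: a_def)
  define c' where "c' = [:inverse a:] \<star> c"
  have c: "c = [:a:] \<star> c'"
    using a by (simp add: c'_def map_poly_times_times [symmetric])
  show ?thesis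
  proof
    show "lead_coeff c' = 1"
      using a by (simp only: c'_def lead_coeff_diff_mult) (simp add: a_def)
    show "degree c' = degree c"
      using a assms by (simp only: c'_def) (subst degree_diff_mult; simp)
    show "right_dvd c' x \<longleftrightarrow> right_dvd c x" for x
      by (metis c c'_def diff_mult_assoc right_dvd_def)
  qed
qed

lemma monic_same_degree_right_dvd:
  assumes "right_dvd c x" "lead_coeff c = 1" "lead_coeff x = 1" "degree x = degree c"
  shows "x = c"
proof -
  obtain q where q: "x = q \<star> c" using assms(1) by (rule right_dvdE)
  have "q \<noteq> 0" "c \<noteq> 0" using q assms by auto
  then have "degree q = 0" using assms(4) q by (simp add: degree_diff_mult)
  then obtain b where "q = [:b:]" by (rule degree_eq_zeroE)
  moreover have "lead_coeff q = 1" using q assms by (simp add: lead_coeff_diff_mult)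
  ultimately show ?thesis using q by simp
qed

lemma mod_right_eqI:
  assumes "f \<noteq> 0" "r = 0 \<or> degree r < degree f" "right_dvd f (h - r)"
  shows "mod_right \<delta> h f = r"
  unfolding mod_right_def
proof (rule the_equality)
  obtain q where "h - r = q \<star> f" using assms(3) by (rule right_dvdE)
  then have q: "h = q \<star> f + r" by (simp add: algebra_simps)
  show "(r = 0 \<or> degree r < degree f) \<and> (\<exists>q. h =
      q \<otimes>\<^bsub>diff_poly_ring \<delta>\<^esub> f + r)"
    using q assms(2) by (auto simp: diff_poly_ring_def)
  fix s assume s: "(s = 0 \<or> degree s < degree f) \<and> (\<exists>q. h =
      q \<otimes>\<^bsub>diff_poly_ring \<delta>\<^esub> f + s)"
  then obtain q' where q': "h = q' \<star> f + s" by (auto simp: diff_poly_ring_def)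
  have "s - r = (q - q') \<star> f"
    using q q' by (simp add: diff_mult_diff_left algebra_simps)
  then have "right_dvd f (s - r)" by (rule right_dvdI)
  moreover have "s - r = 0 \<or> degree (s - r) < degree f"
    using s assms(2) degree_diff_less [of s "degree f" r]
    by (cases "degree f = 0") (auto intro!: le_less_trans [OF degree_diff_le_max])
  ultimately show "s = r" using right_dvd_imp_eq_0 by fastforce
qed

lemma mod_right:
  assumes "f \<noteq> 0"
  shows mod_right_degree: "mod_right \<delta> h f =
      0 \<or> degree (mod_right \<delta> h f) < degree f"
    and mod_right_dvd: "right_dvd f (h - mod_right \<delta> h f)"
proof -
  obtain q r where qr: "h = q \<star> f + r" "r = 0 \<or> degree r < degree f"
    using right_division [OF assms] by blast
  have *: "right_dvd f (h - r)" using qr(1) by (intro right_dvdI [of _ q]) simp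
  have "mod_right \<delta> h f = r" using assms qr(2) * by (rule mod_right_eqI)
  with qr(2) * show "mod_right \<delta> h f = 0 \<or> degree (mod_right \<delta> h f) < degree f"
    "right_dvd f (h - mod_right \<delta> h f)" by simp_all
qed

section \<open>Common right divisors and common left multiples\<close>

text \<open>The bound on \<open>q\<close> says that \<open>k\<close> and \<open>f\<close> have a
  common left multiple of degree below \<open>degree k + degree f\<close>. Dividing f = s k + r
  gives q r = (h - q s) k, a relation of the same kind for \<open>r\<close> and \<open>k\<close>;
  the Euclidean algorithm thus stops at a common divisor, which is not constant.\<close>

lemma common_right_divisor:
  assumes "h \<star> k =
      q \<star> f" "k \<noteq> 0" "f \<noteq> 0" "q \<noteq> 0" "degree q < degree k"
  shows "\<exists>c. 0 < degree c \<and> right_dvd c k \<and> right_dvd c f"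
  using assms
proof (induction "degree k" arbitrary: h k q f rule: less_induct)
  case less
  obtain s r where sr: "f = s \<star> k + r" "r = 0 \<or> degree r < degree k"
    using right_division [OF less.prems(2)] by blast
  show ?case
  proof (cases "r = 0")
    case True
    then show ?thesis
      using sr less.prems by (intro exI [of _ k]) (auto intro: right_dvd_refl right_dvdI)
  next
    case False
    have eq: "q \<star> r = (h - q \<star> s) \<star> k"
      using less.prems(1) sr(1)
        by (simp add: diff_mult_diff_left diff_mult_add_right diff_mult_assoc)
    have nz: "h - q \<star> s \<noteq> 0"
      using eq False less.prems by (metis diff_mult_eq_0_iff)
    have "degree q + degree r = degree (h - q \<star> s) + degree k"
      using degree_diff_mult [of q r] degree_diff_mult [of "h - q \<star> s" k] eq False nz less.prems by simp
    then have "degree (h - q \<star> s) < degree r"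
      using less.prems by linarith
    then obtain c where c: "0 < degree c" "right_dvd c r" "right_dvd c k"
      using less.hyps [OF _ eq False less.prems(2) nz] sr(2) False by blast
    then have "right_dvd c f"
      unfolding sr(1) by (intro right_dvd_add right_dvd_diff_mult)
    with c show ?thesis by blast
  qed
qed

text \<open>The Ore condition, by the same Euclidean recursion: if a = s c + r and x c = y r, then y
  a = (x + y s) c. Comparing degrees in x c = y r carries the bound along.\<close>

lemma common_left_multiple:
  assumes "a \<noteq> 0" "c \<noteq> 0"
  shows "\<exists>x y. x \<noteq> 0 \<and> y \<noteq> 0 \<and> x \<star> a =
      y \<star> c \<and> degree x \<le> degree c"
  using assms
proof (induction "degree c" arbitrary: a c rule: less_induct)
  case less
  obtain s r where sr: "a = s \<star> c + r" "r = 0 \<or> degree r < degree c"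
    using right_division [OF less.prems(2)] by blast
  show ?case
  proof (cases "r = 0")
    case True
    with sr less.prems have "s \<noteq> 0" by auto
    then show ?thesis using True sr by (intro exI [of _ "[:1:]"] exI [of _ s]) simp
  next
    case False
    then obtain x y where xy: "x \<noteq> 0" "y \<noteq> 0" "x \<star> c =
        y \<star> r" "degree x \<le> degree r"
      using less.hyps [of r c] sr(2) less.prems by blast
    have eq: "y \<star> a = (x + y \<star> s) \<star> c"
      using xy(3) by (simp add: sr(1) diff_mult_add_left diff_mult_add_right diff_mult_assoc)
    have "degree x + degree c = degree y + degree r"
      using degree_diff_mult [of x c] degree_diff_mult [of y r] xy False less.prems by simp
    then have "degree y \<le> degree c" using xy(4) by linarith
    moreover have "x + y \<star> s \<noteq> 0"
      using eq xy less.prems by (metis diff_mult_eq_0_iff)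
    ultimately show ?thesis using eq xy by blast
  qed
qed

text \<open>By \<open>common_right_divisor\<close>, coprimality bounds the degree of every nonzero
  common left multiple from below, and \<open>common_left_multiple\<close> attains the bound.
  Division with remainder by this smallest multiple shows that it generates all others.\<close>

lemma least_common_left_multiple:
  assumes "a \<noteq> 0" "c \<noteq> 0"
    and coprime: "\<And>k. right_dvd k a \<Longrightarrow> right_dvd k c \<Longrightarrow>
        degree k = 0"
  obtains l where "lead_coeff l = 1" "degree l = degree a + degree c"
    "\<And>x. right_dvd l x \<longleftrightarrow> right_dvd a x \<and> right_dvd c x"
proof -
  have large: "degree c \<le> degree x" if xy: "x \<star> a = y \<star> c" "x \<noteq> 0" for x y
  proof (rule ccontr)
    assume "\<not> degree c \<le> degree x"
    then obtain k where "0 < degree k" "right_dvd k c" "right_dvd k a"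
      using common_right_divisor [of y c x a] xy assms(1,2) by auto
    then show False using coprime by fastforce
  qed
  obtain x y where xy: "x \<noteq> 0" "y \<noteq> 0" "x \<star> a =
      y \<star> c" "degree x \<le> degree c"
    using common_left_multiple assms by blast
  have deg: "degree x = degree c" using large xy by (simp add: le_antisym)
  have nz: "x \<star> a \<noteq> 0" using xy assms by (simp add: diff_mult_eq_0_iff)
  have xa: "right_dvd a (x \<star> a)" "right_dvd c (x \<star> a)"
    using right_dvdI [of "x \<star> a"] xy(3) by blast+
  have dvd: "right_dvd (x \<star> a) z \<longleftrightarrow>
      right_dvd a z \<and> right_dvd c z" for z
  proof
    assume "right_dvd (x \<star> a) z"
    then show "right_dvd a z \<and> right_dvd c z"
      using xa right_dvd_trans by blast
  next
    assume z: "right_dvd a z \<and> right_dvd c z"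
    obtain w r where wr: "z = w \<star> (x \<star> a) + r" "r =
        0 \<or> degree r < degree (x \<star> a)"
      using right_division [OF nz] by blast
    have r: "r = z - w \<star> (x \<star> a)" using wr(1) by simp
    have "right_dvd a r" "right_dvd c r"
      unfolding r using z xa by (simp_all add: right_dvd_diff right_dvd_diff_mult)
    then obtain x' y' where x': "r = x' \<star> a" "r = y' \<star> c"
      unfolding right_dvd_def by blast
    have "r = 0"
    proof (rule ccontr)
      assume "r \<noteq> 0"
      then have "x' \<noteq> 0" using x' by auto
      then have "degree c \<le> degree x'" using large [of x' y'] x' by simp
      then have "degree (x \<star> a) \<le> degree r"
        using \<open>x' \<noteq> 0\<close> x'(1) xy(1) assms(1) deg by (simp add: degree_diff_mult)
      with wr(2) \<open>r \<noteq> 0\<close> show False by simp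
    qed
    then show "right_dvd (x \<star> a) z" using wr(1) by (intro right_dvdI [of _ w]) simp
  qed
  obtain l where "lead_coeff l = 1" "degree l = degree (x \<star> a)"
    "\<And>z. right_dvd l z \<longleftrightarrow> right_dvd (x \<star> a) z"
    using monic_associate [OF nz] by blast
  with that [of l] dvd deg xy(1) assms(1) show ?thesis by (simp add: degree_diff_mult add.commute)
qed

end

subsection \<open>Characteristic p\<close>

lemma prime_CHAR_division_ring:
  assumes "CHAR('a::division_ring) > 0"
  shows "Factorial_Ring.prime CHAR('a)"
proof (rule prime_natI)
  show "CHAR('a) \<ge> 2"
    using assms CHAR_not_1 [where 'a = 'a] by linarith
  fix m n assume dvd: "CHAR('a) dvd m * n"
  then have "(of_nat m * of_nat n :: 'a) = 0"
    using of_nat_eq_0_iff_char_dvd [where 'a = 'a, of "m * n"] by simp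
  then show "CHAR('a) dvd m \<or> CHAR('a) dvd n"
    by (simp add: of_nat_eq_0_iff_char_dvd)
qed

context differential_division_ring
begin

text \<open>Left multiplication by t + b is the sum of the shift h -> h t and the coefficientwise
  map x -> \<open>\<delta> x + b * x\<close>. These two commute, so the binomial theorem
  applies.\<close>

lemma coeff_twisted_t_times_funpow:
  "coeff (((\<lambda>h. t_times \<delta> h + map_poly ((*) b) h) ^^ m) [:a:]) k =
     of_nat (m choose k) * ((\<lambda>x. \<delta> x + b * x) ^^ (m - k)) a"
proof (induction m arbitrary: k)
  case 0
  then show ?case by (cases k) simp_all
next
  case (Suc m)
  define D where "D = (\<lambda>x. \<delta> x + b * x)"
  define Y where "Y = ((\<lambda>h. t_times \<delta> h + map_poly ((*) b) h) ^^ m) [:a:]"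
  have D: "D (of_nat i * x) = of_nat i * D x" for i x
    by (simp add: D_def delta_of_nat_mult distrib_left) (metis mult.assoc mult_of_nat_commute)
  have IH: "coeff Y k = of_nat (m choose k) * (D ^^ (m - k)) a" for k
    using Suc.IH by (simp add: Y_def D_def)
  have "coeff (t_times \<delta> Y + map_poly ((*) b) Y) k =
      of_nat (Suc m choose k) * (D ^^ (Suc m - k)) a"
  proof (cases k)
    case 0
    then show ?thesis using IH [of 0] by (simp add: coeff_t_times D_def)
  next
    case k: (Suc j)
    \<comment> \<open>For \<open>Suc j > m\<close> the truncated differences agree instead of
      differing by one, but then the binomial coefficient is zero.\<close>
    have "of_nat (m choose Suc j) * D ((D ^^ (m - Suc j)) a) =
        of_nat (m choose Suc j) * (D ^^ (m - j)) a"
    proof (cases "Suc j \<le> m")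
      case True
      then have "m - j = Suc (m - Suc j)" by simp
      then show ?thesis by simp
    qed (simp add: binomial_eq_0)
    moreover have "coeff (t_times \<delta> Y + map_poly ((*) b) Y) k =
        coeff Y j + D (coeff Y (Suc j))"
      by (simp add: k coeff_t_times D_def)
    ultimately show ?thesis
      by (simp add: IH D k distrib_right)
  qed
  then show ?case by (simp add: Y_def D_def)
qed

lemma coeff_t_times_funpow:
  "coeff ((t_times \<delta> ^^ m) [:a:]) k = of_nat (m choose k) * (\<delta> ^^ (m - k)) a"
  using coeff_twisted_t_times_funpow [of m 0 a k] by simp

lemma monom_1_diff_mult: "monom 1 m \<star> h = (t_times \<delta> ^^ m) h"
proof (induction m arbitrary: h)
  case (Suc m)
  then show ?case by (simp add: monom_Suc diff_mult_pCons funpow_swap1)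
qed (simp add: monom_0)

lemma diff_nat_pow_0: "x [^]\<^bsub>diff_poly_ring \<delta>\<^esub> (0::nat) = [:1:]"
  using monoid.nat_pow_0 [OF ring.is_monoid [OF ring_diff_poly_ring]]
  by (simp add: diff_poly_ring_def)

lemma diff_nat_pow_Suc:
  "x [^]\<^bsub>diff_poly_ring \<delta>\<^esub> Suc i =
      x [^]\<^bsub>diff_poly_ring \<delta>\<^esub> i \<star> x"
  using monoid.nat_pow_Suc [OF ring.is_monoid [OF ring_diff_poly_ring]]
  by (simp add: diff_poly_ring_def)

text \<open>Powers grow by multiplication on the right, the iteration by multiplication on the left;
  \<open>nat_pow_Suc2\<close> reconciles them and makes the binomial formula available for powers of
  t + b.\<close>

lemma nat_pow_linear:
  "[:b, 1:] [^]\<^bsub>diff_poly_ring \<delta>\<^esub> m =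
      ((\<lambda>h. t_times \<delta> h + map_poly ((*) b) h) ^^ m) [:1:]"
proof (induction m)
  case 0
  then show ?case by (simp add: nat_pow_def diff_poly_ring_def)
next
  case (Suc m)
  interpret ring "diff_poly_ring \<delta>" by (rule ring_diff_poly_ring)
  have "[:b, 1:] [^]\<^bsub>diff_poly_ring \<delta>\<^esub> Suc m =
      [:b, 1:] \<star> [:b, 1:] [^]\<^bsub>diff_poly_ring \<delta>\<^esub> m"
    using nat_pow_Suc2 [of "[:b, 1:]" m] by (simp add: diff_poly_ring_def)
  then show ?case by (simp add: Suc diff_mult_pCons add.commute)
qed

end

locale char_p_derivation = differential_division_ring \<delta>
  for \<delta> :: "'a::division_ring \<Rightarrow> 'a" +
  fixes p :: nat
  assumes CHAR: "CHAR('a) = p" and p_pos: "p > 0"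
begin

lemma prime_p: "Factorial_Ring.prime p"
  using prime_CHAR_division_ring [where 'a = 'a] CHAR p_pos by simp

lemma p_gt_1: "p > 1"
  using prime_p by (rule prime_gt_1_nat)

lemma of_nat_choose_p:
  assumes "0 < k" "k < p"
  shows "of_nat (p choose k) = (0 :: 'a)"
  using dvd_choose_prime [of k p] prime_p assms CHAR by (simp add: of_nat_eq_0_iff_char_dvd)

text \<open>The inner binomial coefficients vanish in characteristic p, so only the top and the
  constant coefficient survive.\<close>

lemma twisted_t_times_funpow_p:
  "((\<lambda>h. t_times \<delta> h + map_poly ((*) b) h) ^^ p) [:a:] =
      monom a p + [:((\<lambda>x. \<delta> x + b * x) ^^ p) a:]"
proof (rule poly_eqI)
  fix k
  consider "k = 0" | "0 < k" "k < p" | "k = p" | "k > p" by linarith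
  then show "coeff (((\<lambda>h. t_times \<delta> h + map_poly ((*) b) h) ^^ p) [:a:]) k =
      coeff (monom a p + [:((\<lambda>x. \<delta> x + b * x) ^^ p) a:]) k"
    using p_pos
    by cases (auto simp: coeff_twisted_t_times_funpow of_nat_choose_p coeff_pCons binomial_eq_0 split: nat.split)
qed

text \<open>Justifies the definite description in \<open>V_map\<close>. Explicitly, V_p(b) is minus
  the value at 1 of the p-th iterate of x -> \<open>\<delta> x - b * x\<close>.\<close>

lemma linear_power_p:
  "[:- b, 1:] [^]\<^bsub>diff_poly_ring \<delta>\<^esub> p = monom 1 p - [:V_map \<delta> p b:]"
proof -
  define v where "v = - ((\<lambda>x. \<delta> x + (- b) * x) ^^ p) 1"
  have eq: "[:- b, 1:] [^]\<^bsub>diff_poly_ring \<delta>\<^esub> p = monom 1 p - [:v:]"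
    by (simp only: nat_pow_linear twisted_t_times_funpow_p) (simp add: v_def)
  have "V_map \<delta> p b = v"
    unfolding V_map_def by (rule the_equality) (auto simp: eq)
  with eq show ?thesis by simp
qed

lemma t_times_funpow_p: "(t_times \<delta> ^^ p) [:a:] = monom a p + [:(\<delta> ^^ p) a:]"
  using twisted_t_times_funpow_p [of 0 a] by simp

end

text \<open>The minimum polynomial hypotheses enter through these consequences:
  \<open>delta_p\<close> from the one on \<open>D\<close>, and the central eigenvector
  \<open>u\<close> from the one on \<open>C\<close>, by \<open>eigenvector_exists\<close>.\<close>

locale artin_schreier_derivation = char_p_derivation \<delta> p
  for \<delta> :: "'a::division_ring \<Rightarrow> 'a" and p +
  fixes u :: 'a
  assumes delta_p: "(\<delta> ^^ p) a = \<delta> a"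
    and u_nz: "u \<noteq> 0"
    and u_central: "u * a = a * u"
    and delta_u: "\<delta> u = u"
begin

definition artin_schreier_poly :: "'a poly" (\<open>\<gamma>\<close>) where
  "\<gamma> = monom 1 p - monom 1 1"

text \<open>It suffices to commute with constants and with t. For a constant, the extra terms in t^p
  a and t a are the p-th iterate of \<open>\<delta>\<close> at a and \<open>\<delta> a\<close>,
  which are equal by \<open>delta_p\<close>; for t, the coefficients 1 and -1 are killed by
  \<open>\<delta>\<close>.\<close>

lemma gamma_central: "\<gamma> \<star> h = h \<star> \<gamma>"
proof (induction h)
  case (pCons a h)
  have "t_times \<delta> [:a:] = [:\<delta> a, a:]"
    by (simp add: t_times_pCons)
  then have "\<gamma> \<star> [:a:] = monom a p + [:\<delta> a:] - [:\<delta> a, a:]"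
    by (simp add: artin_schreier_poly_def diff_mult_diff_left monom_1_diff_mult t_times_funpow_p delta_p)
  then have const: "\<gamma> \<star> [:a:] = [:a:] \<star> \<gamma>"
    by (auto simp: artin_schreier_poly_def poly_eq_iff coeff_pCons right_diff_distrib split: nat.split)
  have "\<gamma> \<star> [:0, 1:] = t_times \<delta> \<gamma>"
    by (auto simp: artin_schreier_poly_def diff_mult_right_t poly_eq_iff coeff_t_times coeff_pCons delta_diff split: nat.split)
  then have t: "\<gamma> \<star> [:0, 1:] = [:0, 1:] \<star> \<gamma>"
    by (simp add: diff_mult_t)
  have "\<gamma> \<star> pCons a h = \<gamma> \<star> [:a:] + \<gamma> \<star> h \<star> [:0, 1:]"
    by (simp only: pCons_eq_diff_mult [of a h] diff_mult_add_right diff_mult_assoc)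
  also have "\<dots> = [:a:] \<star> \<gamma> + h \<star> [:0, 1:] \<star> \<gamma>"
    by (simp only: const t pCons.IH diff_mult_assoc)
  also have "\<dots> = pCons a h \<star> \<gamma>"
    by (simp only: pCons_eq_diff_mult [of a h] diff_mult_add_left)
  finally show ?case .
qed simp

section \<open>Conjugation by the eigenvector \<open>u\<close>\<close>

lemma delta_inverse_u: "\<delta> (inverse u) = - inverse u"
proof -
  have "u * inverse u + u * \<delta> (inverse u) = 0"
    using delta_mult [of u "inverse u"] u_nz by (simp add: delta_u)
  then have "u * (inverse u + \<delta> (inverse u)) = 0"
    by (simp add: distrib_left)
  then show ?thesis using u_nz by (simp add: eq_neg_iff_add_eq_0 add.commute)
qed

definition conj_u where "conj_u h = [:u:] \<star> h \<star> [:inverse u:]"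

lemma u_inverse_u [simp]:
  "[:u:] \<star> [:inverse u:] = [:1:]" "[:inverse u:] \<star> [:u:] = [:1:]"
  using u_nz by (simp_all add: map_poly_pCons)

lemma u_inverse_u_cancel [simp]:
  "[:u:] \<star> ([:inverse u:] \<star> h) = h" "[:inverse u:] \<star> ([:u:] \<star> h) = h"
  by (simp_all only: diff_mult_assoc [symmetric] u_inverse_u) simp_all

lemma conj_u_add: "conj_u (g + h) = conj_u g + conj_u h"
  by (simp only: conj_u_def diff_mult_add_left diff_mult_add_right)

lemma conj_u_diff: "conj_u (g - h) = conj_u g - conj_u h"
  by (simp only: conj_u_def diff_mult_diff_left diff_mult_diff_right)

lemma conj_u_0 [simp]: "conj_u 0 = 0"
  by (simp add: conj_u_def)

lemma conj_u_sum: "conj_u (sum h A) = (\<Sum>i\<in>A. conj_u (h i))"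
  by (induction A rule: infinite_finite_induct) (simp_all add: conj_u_add)

lemma conj_u_mult: "conj_u (g \<star> h) = conj_u g \<star> conj_u h"
  by (simp only: conj_u_def diff_mult_assoc u_inverse_u_cancel)

lemma conj_u_const [simp]: "conj_u [:a:] = [:a:]"
proof -
  have "u * a * inverse u = a"
    using u_nz by (simp only: u_central mult.assoc) simp
  then show ?thesis by (simp add: conj_u_def map_poly_pCons)
qed

text \<open>By \<open>delta_inverse_u\<close>, t passes \<open>inverse u\<close> as t - 1.\<close>

lemma conj_u_t: "conj_u [:0, 1:] = [:- 1, 1:]"
  using u_nz
  by (simp add: conj_u_def diff_mult_assoc diff_mult_t t_times_pCons delta_inverse_u map_poly_pCons
      del: diff_mult_const) (simp add: map_poly_pCons)

lemma degree_conj_u [simp]: "degree (conj_u h) = degree h"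
  using u_nz
    by (cases "h = 0") (simp_all add: conj_u_def degree_diff_mult diff_mult_eq_0_iff del: diff_mult_const)

lemma lead_coeff_conj_u [simp]: "lead_coeff (conj_u h) = lead_coeff h"
  using u_nz
    by (simp add: conj_u_def lead_coeff_diff_mult u_central mult.assoc del: diff_mult_const degree_conj_u)

lemma conj_u_gamma [simp]: "conj_u \<gamma> = \<gamma>"
  by (simp only: conj_u_def gamma_central [symmetric] diff_mult_assoc u_inverse_u diff_mult_1_right)

text \<open>Both maps fix constants and send t to t - 1. Since \<open>conj_u\<close> is additive and
  multiplicative by construction, so is \<open>G_id_minus1\<close>.\<close>

lemma G_id_minus1_eq_conj_u: "G_id_minus1 \<delta> h = conj_u h"
proof -
  have pow: "[:- 1, 1:] [^]\<^bsub>diff_poly_ring \<delta>\<^esub> i = conj_u (monom 1 i)" for i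
  proof (induction i)
    case 0
    then show ?case by (simp only: diff_nat_pow_0) (simp add: monom_0)
  next
    case (Suc i)
    have "monom 1 (Suc i) = monom (1::'a) i \<star> [:0, 1:]"
      by (simp add: diff_mult_right_t monom_Suc)
    then show ?case by (simp only: diff_nat_pow_Suc Suc conj_u_mult conj_u_t)
  qed
  have "G_id_minus1 \<delta> h = (\<Sum>i\<le>degree h. conj_u ([:coeff h i:] \<star> monom 1 i))"
    unfolding G_id_minus1_def pow
    by (simp add: conj_u_mult diff_poly_ring_def del: diff_mult_const)
  also have "\<dots> = conj_u (\<Sum>i\<le>degree h. monom (coeff h i) i)"
    by (simp add: conj_u_sum map_poly_monom)
  finally show ?thesis by (simp add: poly_as_sum_of_monoms)
qed

text \<open>To the coefficient of t^(m-1) in h \<open>inverse u\<close>, only the terms of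
  \<open>h\<close> of degree m and m - 1 contribute. Moving t^m past \<open>inverse u\<close> yields
  the binomial factor m and one derivative, whence the sign.\<close>

lemma conj_u_subleading:
  assumes "lead_coeff h = 1" "0 < degree h"
  shows "coeff (conj_u h) (degree h - 1) = coeff h (degree h - 1) - of_nat (degree h)"
proof -
  define m where "m = degree h"
  have m: "0 < m" "coeff h m = 1" using assms by (simp_all add: m_def)
  let ?f = "\<lambda>i. coeff h i * (of_nat (i choose (m - 1)) * (\<delta> ^^ (i - (m - 1))) (inverse u))"
  have "coeff (h \<star> [:inverse u:]) (m - 1) = (\<Sum>i\<le>m. ?f i)"
    by (simp add: diff_mult_def m_def coeff_sum coeff_t_times_funpow)
  also have "\<dots> = (\<Sum>i\<in>{m - 1, m}. ?f i)"
    by (rule sum.mono_neutral_right) (auto simp: binomial_eq_0)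
  also have "\<dots> = coeff h (m - 1) * inverse u - of_nat m * inverse u"
  proof -
    have "m choose (m - 1) = m" using m(1) by (cases m) simp_all
    then show ?thesis using m
      by (simp add: delta_inverse_u Suc_diff_Suc flip: One_nat_def) (simp add: delta_inverse_u)
  qed
  finally have "coeff (conj_u h) (m - 1) = u * (coeff h (m - 1) - of_nat m) * inverse u"
    by (simp add: conj_u_def diff_mult_assoc left_diff_distrib right_diff_distrib mult.assoc del: diff_mult_const)
      (simp add: left_diff_distrib right_diff_distrib mult.assoc)
  then show ?thesis using u_nz by (simp only: u_central mult.assoc m_def) simp
qed

text \<open>Invariance makes \<open>of_nat (degree h)\<close> vanish in \<open>D\<close>.\<close>

lemma conj_u_invariant_degree:
  assumes "lead_coeff h = 1" "0 < degree h" "conj_u h = h"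
  shows "p dvd degree h"
  using conj_u_subleading [OF assms(1,2)] assms(3) CHAR
  by (simp add: of_nat_eq_0_iff_char_dvd)

end

subsection \<open>Right divisors of minimal degree\<close>

context artin_schreier_derivation
begin

lemma conj_u_eqI: "[:inverse u:] \<star> h \<star> [:u:] = h \<Longrightarrow> conj_u h = h"
  by (metis conj_u_def diff_mult_1_right diff_mult_assoc u_inverse_u(1) u_inverse_u_cancel(1))

lemma minimal_right_divisor_degree:
  assumes f: "degree f = p" "conj_u f = f"
    and c: "right_dvd c f" "0 < degree c"
    and minimal: "\<And>e. right_dvd e f \<Longrightarrow> 0 < degree e \<Longrightarrow>
        degree c \<le> degree e"
  shows "degree c dvd p"
proof -
  have f_nz: "f \<noteq> 0" using f(1) p_pos by auto
  define S where "S = {e. lead_coeff e = 1 \<and> degree e = degree c \<and> right_dvd e f}"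
  \<comment> \<open>\<open>Q\<close> describes candidates for the least common left multiple of
    \<open>S\<close>: they divide every common left multiple of \<open>S\<close>, but need not be
    one themselves. A candidate of maximal degree is one, and choosing it by maximality avoids any
    finiteness of \<open>S\<close>.\<close>
  define Q where "Q = (\<lambda>h. lead_coeff h =
      1 \<and> 0 < degree h \<and> right_dvd h f \<and> degree c dvd degree h \<and>
      (\<forall>x. (\<forall>e\<in>S. right_dvd e x) \<longrightarrow> right_dvd h x))"
  obtain c' where c': "lead_coeff c' = 1" "degree c' =
      degree c" "\<And>x. right_dvd c' x \<longleftrightarrow> right_dvd c x"
    using monic_associate [of c] c(2) by (metis degree_0 less_nat_zero_code)
  have "c' \<in> S" using c c' by (simp add: S_def)
  then have "Q c'" using c c' unfolding Q_def by auto
  moreover have "\<forall>h. Q h \<longrightarrow> degree h < Suc p"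
    using right_dvd_degree_le [OF _ f_nz] by (auto simp: Q_def f(1) less_Suc_eq_le)
  ultimately have "\<exists>h. Q h \<and> (\<forall>h'. Q h' \<longrightarrow> degree h' \<le> degree h)"
    by (rule ex_has_greatest_nat)
  then obtain h where h: "Q h" and max: "\<And>h'. Q h' \<Longrightarrow> degree h' \<le> degree h"
    by blast
  have h': "lead_coeff h = 1" "0 < degree h" "right_dvd h f" "degree c dvd degree h"
    "\<And>x. (\<And>e. e \<in> S \<Longrightarrow> right_dvd e x) \<Longrightarrow> right_dvd h x"
    using h by (auto simp: Q_def)
  have h_nz: "h \<noteq> 0" using h'(2) by auto
  have S_dvd: "right_dvd e h" if "e \<in> S" for e
  proof (rule ccontr)
    assume ndvd: "\<not> right_dvd e h"
    have e: "lead_coeff e = 1" "degree e = degree c" "right_dvd e f"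
      using that by (auto simp: S_def)
    then have e_nz: "e \<noteq> 0" by auto
    \<comment> \<open>A common divisor of positive degree would divide \<open>f\<close>, so by
      minimality it would have the degree of \<open>e\<close> and be associated to \<open>e\<close>;
      then \<open>e\<close> would divide \<open>h\<close>.\<close>
    have "degree k = 0" if k: "right_dvd k h" "right_dvd k e" for k
    proof (rule ccontr)
      assume pos: "degree k \<noteq> 0"
      then obtain k' where k': "lead_coeff k' = 1" "degree k' =
          degree k" "\<And>x. right_dvd k' x \<longleftrightarrow> right_dvd k x"
        using monic_associate [of k] by (metis degree_0)
      have "degree c \<le> degree k"
        using minimal [of k] pos k e(3) right_dvd_trans by blast
      moreover have "degree k \<le> degree e"
        using right_dvd_degree_le [OF k(2) e_nz] .
      ultimately have "e = k'"
        using monic_same_degree_right_dvd [of k' e] k k' e by simp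
      with k' k ndvd show False by simp
    qed
    then obtain l where l: "lead_coeff l = 1" "degree l = degree h + degree e"
      "\<And>x. right_dvd l x \<longleftrightarrow> right_dvd h x \<and> right_dvd e x"
      using least_common_left_multiple [OF h_nz e_nz] by blast
    \<comment> \<open>Adjoining \<open>e\<close> preserves \<open>Q\<close> and raises the degree by
      exactly \<open>degree c\<close>, so divisibility by \<open>degree c\<close> survives and
      maximality of \<open>h\<close> is violated.\<close>
    have "Q l"
      unfolding Q_def using l h' e that by simp
    from max [OF this] l(2) e(2) c(2) show False by simp
  qed
  \<comment> \<open>Conjugation by \<open>u\<close> fixes \<open>f\<close> and so maps
    \<open>S\<close> into itself. Therefore the inverse conjugate of \<open>h\<close> is again a
    common left multiple of \<open>S\<close>; being monic of the same degree, it equals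
    \<open>h\<close>.\<close>
  have "right_dvd h ([:inverse u:] \<star> h \<star> [:u:])"
  proof (rule h'(5))
    fix e assume e: "e \<in> S"
    have "right_dvd (conj_u e) f"
      using e f(2) by (metis (mono_tags) S_def conj_u_mult mem_Collect_eq right_dvd_def)
    then have "conj_u e \<in> S" using e lead_coeff_conj_u [of e] unfolding S_def by auto
    then obtain q where q: "h = q \<star> conj_u e" using S_dvd right_dvdE by blast
    have "[:inverse u:] \<star> h \<star> [:u:] = [:inverse u:] \<star> q \<star> [:u:] \<star> e"
      by (simp only: q conj_u_def diff_mult_assoc u_inverse_u diff_mult_1_right)
    then show "right_dvd e ([:inverse u:] \<star> h \<star> [:u:])" by (rule right_dvdI)
  qed
  then have "[:inverse u:] \<star> h \<star> [:u:] = h"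
  proof (rule monic_same_degree_right_dvd)
    show "lead_coeff ([:inverse u:] \<star> h \<star> [:u:]) = 1"
      using h'(1) u_nz by (simp only: lead_coeff_diff_mult) simp
    show "degree ([:inverse u:] \<star> h \<star> [:u:]) = degree h"
      using u_nz h_nz by (simp add: degree_diff_mult diff_mult_eq_0_iff del: diff_mult_const)
  qed (rule h'(1))
  then have "p dvd degree h"
    using h'(1,2) by (intro conj_u_invariant_degree conj_u_eqI)
  moreover have "degree h \<le> p"
    using right_dvd_degree_le [OF h'(3) f_nz] f(1) by simp
  ultimately have "degree h = p" using h'(2) by (meson dvd_imp_le le_antisym)
  then show ?thesis using h'(4) by simp
qed

section \<open>The polynomial t^p - t - d and its right factors\<close>

definition petit_poly :: "'a \<Rightarrow> 'a poly" where
  "petit_poly d = \<gamma> - [:d:]"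

lemmas petit_poly_defs = petit_poly_def artin_schreier_poly_def

lemma coeff_petit_poly_top: "coeff (petit_poly d) p = 1"
  using p_gt_1 by (simp add: petit_poly_defs coeff_pCons split: nat.split)

lemma degree_petit_poly: "degree (petit_poly d) = p"
proof (rule antisym)
  show "degree (petit_poly d) \<le> p"
    using p_gt_1 by (intro degree_le) (auto simp: petit_poly_defs coeff_pCons split: nat.split)
  show "p \<le> degree (petit_poly d)"
    by (rule le_degree) (simp only: coeff_petit_poly_top, simp)
qed

lemma petit_poly_nz: "petit_poly d \<noteq> 0"
  using coeff_petit_poly_top [of d] by auto

lemma conj_u_petit_poly: "conj_u (petit_poly d) = petit_poly d"
  by (simp only: petit_poly_def conj_u_diff conj_u_gamma conj_u_const)

text \<open>Subtracting (t-z)^p - (t-z) from t^p - t - d leaves a constant, because (t-z)^p = t^p -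
  V_p(z). That constant is the remainder on right division by t - z.\<close>

lemma petit_poly_linear_division:
  "petit_poly d = ([:- z, 1:] [^]\<^bsub>diff_poly_ring \<delta>\<^esub> (p - 1) - [:1:]) \<star> [:- z, 1:] + [:V_map \<delta> p z - z - d:]"
proof -
  have "[:- z, 1:] [^]\<^bsub>diff_poly_ring \<delta>\<^esub> (p - 1) \<star> [:- z, 1:] =
      monom 1 p - [:V_map \<delta> p z:]"
    using diff_nat_pow_Suc [of "[:- z, 1:]" "p - 1"] p_pos by (simp add: linear_power_p)
  then show ?thesis
    by (simp add: petit_poly_defs diff_mult_diff_left monom_Suc monom_0)
qed

lemma right_dvd_linear_iff:
  "right_dvd [:- z, 1:] (petit_poly d) \<longleftrightarrow> d = V_map \<delta> p z - z"
proof
  assume dvd: "right_dvd [:- z, 1:] (petit_poly d)"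
  let ?q = "[:- z, 1:] [^]\<^bsub>diff_poly_ring \<delta>\<^esub> (p - 1) - [:1:]"
  have "[:V_map \<delta> p z - z - d:] = petit_poly d - ?q \<star> [:- z, 1:]"
    by (subst petit_poly_linear_division [of d z]) simp
  moreover have "right_dvd [:- z, 1:] (petit_poly d - ?q \<star> [:- z, 1:])"
    using dvd right_dvdI by (intro right_dvd_diff) auto
  ultimately have "right_dvd [:- z, 1:] [:V_map \<delta> p z - z - d:]" by simp
  then have "[:V_map \<delta> p z - z - d:] = 0"
    by (rule right_dvd_imp_eq_0) simp
  then show "d = V_map \<delta> p z - z" by simp
next
  assume "d = V_map \<delta> p z - z"
  then show "right_dvd [:- z, 1:] (petit_poly d)"
    using petit_poly_linear_division [of d z] by (intro right_dvdI) simp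
qed

text \<open>A right divisor of least positive degree has degree dividing the prime \<open>p\<close>
  and below \<open>p\<close>, so it is linear.\<close>

lemma petit_poly_linear_right_divisor:
  assumes "right_dvd c (petit_poly d)" "0 < degree c" "degree c < p"
  obtains z where "d = V_map \<delta> p z - z"
proof -
  let ?P = "\<lambda>e. right_dvd e (petit_poly d) \<and> 0 < degree e"
  obtain e where e: "?P e" and min: "\<And>e'. ?P e' \<Longrightarrow> degree e \<le> degree e'"
    using ex_has_least_nat [of ?P c degree] assms by blast
  have "degree e dvd p"
    using e min
      by (intro minimal_right_divisor_degree [OF degree_petit_poly conj_u_petit_poly, of e d]) auto
  moreover have "degree e < p" using min [of c] assms by simp
  ultimately have deg: "degree e = 1"
    using prime_p by (metis less_irrefl prime_nat_iff)
  then obtain k where k: "lead_coeff k = 1" "degree k =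
      degree e" "\<And>x. right_dvd k x \<longleftrightarrow> right_dvd e x"
    using monic_associate [of e] by (metis degree_0 zero_neq_one)
  define a where "a = coeff k 0"
  have "k = [:- (- a), 1:]"
    using k deg by (auto simp: a_def poly_eq_iff coeff_pCons coeff_eq_0 split: nat.split)
  then have "d = V_map \<delta> p (- a) - (- a)"
    using right_dvd_linear_iff [of "- a" d] k(3) e by simp
  then show ?thesis by (rule that)
qed

text \<open>If h k = q f, then \<open>degree h < p\<close> forces
  \<open>degree q < degree k\<close>. So \<open>k\<close> and \<open>f\<close> share a nonconstant
  right divisor of degree below \<open>p\<close>, and \<open>f\<close> has a linear right
  factor.\<close>

lemma petit_poly_no_zero_divisors:
  assumes "\<And>z. d \<noteq> V_map \<delta> p z - z"
    and "degree h < p" "degree k < p" "right_dvd (petit_poly d) (h \<star> k)"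
  shows "h = 0 \<or> k = 0"
proof (rule ccontr)
  assume "\<not> (h = 0 \<or> k = 0)"
  then have nz: "h \<noteq> 0" "k \<noteq> 0" by auto
  obtain q where q: "h \<star> k = q \<star> petit_poly d" using assms(4) by (rule right_dvdE)
  then have q_nz: "q \<noteq> 0" using nz by (auto simp: diff_mult_eq_0_iff)
  have "degree h + degree k = degree q + p"
    using degree_diff_mult [of h k] degree_diff_mult [of q "petit_poly d"] nz q_nz q petit_poly_nz [of d]
    by (simp add: degree_petit_poly)
  then have "degree q < degree k" using assms(2) by simp
  then obtain c where c: "0 < degree c" "right_dvd c k" "right_dvd c (petit_poly d)"
    using common_right_divisor [OF q nz(2) petit_poly_nz q_nz] by blast
  have "degree c < p" using right_dvd_degree_le [OF c(2) nz(2)] assms(3) by simp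
  with c assms(1) show False by (metis petit_poly_linear_right_divisor)
qed

end

subsection \<open>Linear algebra and power sums\<close>

lemma ring_ring_of_type_algebra: "ring (ring_of_type_algebra :: 'a::ring_1 ring)"
proof -
  have "\<exists>y. x + y = 0" for x :: 'a
    using add.right_inverse by blast
  then show ?thesis
    unfolding ring_of_type_algebra_def
    by unfold_locales (auto simp: algebra_simps Units_def)
qed

lemma a_inv_ring_of_type_algebra:
  "\<ominus>\<^bsub>ring_of_type_algebra\<^esub> x = - (x :: 'a::ring_1)"
proof -
  interpret R: ring "ring_of_type_algebra :: 'a ring" by (rule ring_ring_of_type_algebra)
  show ?thesis
    by (rule R.minus_equality) (simp_all add: ring_of_type_algebra_def)
qed

lemma subfield_ring_of_type_algebraI:
  fixes K :: "'a::division_ring set"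
  assumes one: "1 \<in> K" and minus: "\<And>x. x \<in> K \<Longrightarrow> - x \<in> K"
    and add: "\<And>x y. x \<in> K \<Longrightarrow> y \<in> K \<Longrightarrow> x + y \<in> K"
    and mult: "\<And>x y. x \<in> K \<Longrightarrow> y \<in> K \<Longrightarrow> x * y \<in> K"
    and inverse: "\<And>x. x \<in> K \<Longrightarrow> inverse x \<in> K"
    and comm: "\<And>x y. x \<in> K \<Longrightarrow> y \<in> K \<Longrightarrow> x * y = y * x"
  shows "subfield K ring_of_type_algebra"
proof -
  let ?R = "ring_of_type_algebra :: 'a ring"
  interpret R: ring ?R by (rule ring_ring_of_type_algebra)
  have "subcring K ?R"
    by (intro R.subcringI R.subringI)
      (auto simp: a_inv_ring_of_type_algebra one minus intro: comm,
       auto simp: ring_of_type_algebra_def intro: one add mult comm)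
  moreover have "Units (?R\<lparr>carrier := K\<rparr>) = K - {\<zero>\<^bsub>?R\<^esub>}"
  proof (intro equalityI subsetI)
    fix x assume "x \<in> K - {\<zero>\<^bsub>?R\<^esub>}"
    then have "x \<in> K" "x \<noteq> 0" by (auto simp: ring_of_type_algebra_def)
    then show "x \<in> Units (?R\<lparr>carrier := K\<rparr>)"
      unfolding Units_def ring_of_type_algebra_def
      by (auto intro!: bexI [of _ "inverse x"] inverse)
  qed (auto simp: Units_def ring_of_type_algebra_def)
  ultimately show ?thesis by (rule R.subfieldI)
qed

section \<open>Dimension and injective linear maps\<close>

text \<open>Scalars may change along \<open>\<sigma>\<close>: with the embedding of constants it
  transports dimensions from \<open>D\<close> to \<open>D[t;\<delta>]\<close>, with the identity it
  serves endomorphisms. The induction follows the line extensions, and injectivity keeps the image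
  of the new vector outside the image of the smaller space.\<close>

lemma dimension_linear_image:
  assumes R: "ring R" and S: "ring S" and K: "subfield K R"
    and closed: "\<And>x. x \<in> carrier R \<Longrightarrow> \<phi> x \<in> carrier S"
    and add: "\<And>x y. x \<in> carrier R \<Longrightarrow> y \<in> carrier R \<Longrightarrow>
        \<phi> (x \<oplus>\<^bsub>R\<^esub> y) = \<phi> x \<oplus>\<^bsub>S\<^esub> \<phi> y"
    and smult: "\<And>k x. k \<in> K \<Longrightarrow> x \<in> carrier R \<Longrightarrow>
        \<phi> (k \<otimes>\<^bsub>R\<^esub> x) = \<sigma> k \<otimes>\<^bsub>S\<^esub> \<phi> x"
    and dim: "ring.dimension R n K E" and inj: "inj_on \<phi> E"
  shows "ring.dimension S n (\<sigma> ` K) (\<phi> ` E)"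
proof -
  interpret R: ring R by (rule R)
  interpret S: ring S by (rule S)
  have K': "K \<subseteq> carrier R" "\<zero>\<^bsub>R\<^esub> \<in> K" "\<one>\<^bsub>R\<^esub> \<in> K"
    using K by (auto dest: subfieldE)
  have zero: "\<phi> \<zero>\<^bsub>R\<^esub> = \<zero>\<^bsub>S\<^esub>"
    using add [of "\<zero>\<^bsub>R\<^esub>" "\<zero>\<^bsub>R\<^esub>"] closed [of "\<zero>\<^bsub>R\<^esub>"] by simp
  show ?thesis
    using dim inj
  proof (induction n arbitrary: E)
    case 0
    then have "E = {\<zero>\<^bsub>R\<^esub>}" using R.dimension_zero [OF K] by simp
    then show ?case by (simp add: zero)
  next
    case (Suc n)
    obtain v E' where v: "v \<in> carrier R" "v \<notin> E'" and dim': "R.dimension n K E'"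
      and E: "E = R.line_extension K v E'"
      using R.dimension_backwards [OF K Suc.prems(1)] by blast
    have E': "E' \<subseteq> carrier R" "\<zero>\<^bsub>R\<^esub> \<in> E'"
      using R.space_subgroup_props [OF K dim'] by auto
    have sub: "E' \<subseteq> E"
    proof
      fix x assume x: "x \<in> E'"
      then have "x = \<zero>\<^bsub>R\<^esub> \<otimes>\<^bsub>R\<^esub> v \<oplus>\<^bsub>R\<^esub> x" using v E' by (auto simp: subset_iff)
      then show "x \<in> E" using x K' by (auto simp: E R.line_extension_mem_iff)
    qed
    have "v = \<one>\<^bsub>R\<^esub> \<otimes>\<^bsub>R\<^esub> v \<oplus>\<^bsub>R\<^esub> \<zero>\<^bsub>R\<^esub>" using v by simp
    then have vE: "v \<in> E" using K' E' unfolding E R.line_extension_mem_iff by blast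
    have "\<phi> v \<notin> \<phi> ` E'"
      using Suc.prems(2) vE sub v(2) by (auto dest!: inj_onD)
    moreover have "S.dimension n (\<sigma> ` K) (\<phi> ` E')"
      using Suc.IH [OF dim'] Suc.prems(2) sub inj_on_subset by blast
    ultimately have "S.dimension (Suc n) (\<sigma> ` K) (S.line_extension (\<sigma> ` K) (\<phi> v) (\<phi> ` E'))"
      using closed v(1) by (intro S.Suc_dim)
    moreover have "S.line_extension (\<sigma> ` K) (\<phi> v) (\<phi> ` E') = \<phi> ` E"
    proof -
      have "\<phi> (k \<otimes>\<^bsub>R\<^esub> v \<oplus>\<^bsub>R\<^esub> x) =
          \<sigma> k \<otimes>\<^bsub>S\<^esub> \<phi> v \<oplus>\<^bsub>S\<^esub> \<phi> x" if "k \<in> K" "x \<in> E'" for k x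
        using that v E' K' by (simp add: add smult subset_iff)
      then have *: "(\<exists>k\<in>K. \<exists>x\<in>E'. y =
          \<phi> (k \<otimes>\<^bsub>R\<^esub> v \<oplus>\<^bsub>R\<^esub> x)) \<longleftrightarrow>
          (\<exists>k\<in>K. \<exists>x\<in>E'. y = \<sigma> k \<otimes>\<^bsub>S\<^esub> \<phi> v \<oplus>\<^bsub>S\<^esub> \<phi> x)" for y
        by simp
      have "y \<in> S.line_extension (\<sigma> ` K) (\<phi> v) (\<phi> ` E') \<longleftrightarrow>
          (\<exists>k\<in>K. \<exists>x\<in>E'. y = \<sigma> k \<otimes>\<^bsub>S\<^esub> \<phi> v \<oplus>\<^bsub>S\<^esub> \<phi> x)" for y
        by (simp add: S.line_extension_mem_iff)
      moreover have "y \<in> \<phi> ` E \<longleftrightarrow>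
          (\<exists>k\<in>K. \<exists>x\<in>E'. y = \<phi> (k \<otimes>\<^bsub>R\<^esub> v \<oplus>\<^bsub>R\<^esub> x))" for y
        unfolding image_iff Bex_def E R.line_extension_mem_iff by blast
      ultimately show ?thesis using * by blast
    qed
    ultimately show ?case by simp
  qed
qed

text \<open>A basis of \<open>E'\<close> is an independent list of full length in \<open>E\<close>,
  so it spans \<open>E\<close> too.\<close>

lemma (in ring) dimension_subspace_eq:
  assumes "subfield K R" "dimension n K E" "dimension n K E'" "E' \<subseteq> E"
  shows "E' = E"
proof -
  obtain Us where "independent K Us" "length Us = n" "Span K Us = E'" "set Us \<subseteq> carrier R"
    using exists_base [OF assms(1,3)] by blast
  then show ?thesis
    using independent_length_eq_dimension [OF assms(1,2), of Us] Span_base_incl [OF assms(1), of Us] assms(4)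
    by auto
qed

text \<open>Telescoping (i+1)^(k+1) - i^(k+1) expresses (k+1) times the k-th power sum through
  p^(k+1) and lower power sums; k + 1 < p is prime to p.\<close>

lemma prime_dvd_power_sum:
  assumes "Factorial_Ring.prime p" "Suc k < p"
  shows "int p dvd (\<Sum>i<p. int i ^ k)"
  using assms(2)
proof (induction k rule: less_induct)
  case (less k)
  let ?S = "\<lambda>j. \<Sum>i<p. int i ^ j"
  have step: "(int i + 1) ^ Suc k - int i ^ Suc k =
      (\<Sum>j\<le>k. int (Suc k choose j) * int i ^ j)" for i
    by (subst binomial_ring) simp
  have "int p ^ Suc k = (\<Sum>i<p. (int (Suc i)) ^ Suc k - int i ^ Suc k)"
    by (subst sum_lessThan_telescope) simp
  also have "\<dots> = (\<Sum>i<p. \<Sum>j\<le>k. int (Suc k choose j) * int i ^ j)"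
    using step by (intro sum.cong) (auto simp: add.commute)
  also have "\<dots> = (\<Sum>j\<le>k. int (Suc k choose j) * ?S j)"
    by (subst sum.swap) (simp add: sum_distrib_left)
  also have "\<dots> = (\<Sum>j<k. int (Suc k choose j) * ?S j) + int (Suc k) * ?S k"
    by (simp flip: lessThan_Suc_atMost)
  finally have eq: "int (Suc k) * ?S k = int p ^ Suc k - (\<Sum>j<k. int (Suc k choose j) * ?S j)"
    by simp
  have "int p dvd (\<Sum>j<k. int (Suc k choose j) * ?S j)"
  proof (rule dvd_sum)
    fix j assume "j \<in> {..<k}"
    with less show "int p dvd int (Suc k choose j) * ?S j" by (intro dvd_mult) auto
  qed
  then have "int p dvd int (Suc k) * ?S k"
    unfolding eq by (intro dvd_diff dvd_power) simp_all
  moreover have "\<not> int p dvd int (Suc k)"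
    using less.prems by (simp only: int_dvd_int_iff) (auto dest!: dvd_imp_le)
  moreover have "Factorial_Ring.prime (int p)"
    using assms(1) by simp
  ultimately show ?case
    by (blast dest: prime_dvd_multD)
qed

subsection \<open>The dimension of the centre over the constants\<close>

locale central_artin_schreier = artin_schreier_derivation \<delta> p u
  for \<delta> :: "'a::division_ring \<Rightarrow> 'a" and p u +
  fixes C F :: "'a set"
  assumes C_eq: "C = {c. \<forall>x. c * x = x * c}"
    and F_eq: "F = {a \<in> C. \<delta> a = 0}"
begin

lemma C_iff: "c \<in> C \<longleftrightarrow> (\<forall>x. c * x = x * c)"
  by (simp add: C_eq)

lemma C_comm: "c \<in> C \<Longrightarrow> c * x = x * c"
  by (simp add: C_iff)

lemma zero_in_C [simp]: "0 \<in> C" and one_in_C [simp]: "1 \<in> C"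
  by (simp_all add: C_iff)

lemma inverse_in_C: "c \<in> C \<Longrightarrow> inverse c \<in> C"
  unfolding C_iff using mult_commute_imp_mult_inverse_commute by blast

lemma mult_in_C: "a \<in> C \<Longrightarrow> b \<in> C \<Longrightarrow> a * b \<in> C"
  unfolding C_iff by (metis mult.assoc)

lemma minus_in_C: "a \<in> C \<Longrightarrow> - a \<in> C"
  unfolding C_iff by (metis mult_minus_left mult_minus_right)

lemma diff_in_C: "a \<in> C \<Longrightarrow> b \<in> C \<Longrightarrow> a - b \<in> C"
  unfolding C_iff by (metis left_diff_distrib right_diff_distrib)

lemma add_in_C: "a \<in> C \<Longrightarrow> b \<in> C \<Longrightarrow> a + b \<in> C"
  unfolding C_iff by (metis distrib_left distrib_right)

lemma sum_in_C:
  "(\<And>i. i \<in> A \<Longrightarrow> h i \<in> C) \<Longrightarrow> sum h A \<in> C"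
  by (induction A rule: infinite_finite_induct) (simp_all add: add_in_C)

lemma of_nat_in_C: "of_nat m \<in> C"
  by (simp add: C_iff mult_of_nat_commute)

lemma power_in_C: "a \<in> C \<Longrightarrow> a ^ m \<in> C"
  by (induction m) (simp_all add: mult_in_C)

lemma delta_in_C: "c \<in> C \<Longrightarrow> \<delta> c \<in> C"
  using delta_central by (simp add: C_iff)

lemma delta_funpow_in_C: "c \<in> C \<Longrightarrow> (\<delta> ^^ m) c \<in> C"
  by (induction m) (auto simp: delta_in_C)

lemma u_in_C: "u \<in> C"
  by (simp add: C_iff u_central)

lemma F_subset_C: "F \<subseteq> C"
  by (auto simp: F_eq)

lemma delta_F: "a \<in> F \<Longrightarrow> \<delta> a = 0"
  by (simp add: F_eq)

lemma subfield_F: "subfield F ring_of_type_algebra"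
proof (rule subfield_ring_of_type_algebraI)
  fix x assume x: "x \<in> F"
  show "inverse x \<in> F"
  proof (cases "x = 0")
    case False
    have "x * \<delta> (inverse x) = 0"
      using delta_mult [of x "inverse x"] x False by (simp add: F_eq)
    with x False show ?thesis by (auto simp: F_eq inverse_in_C)
  qed (use x in simp)
qed (auto simp: F_eq mult_in_C add_in_C minus_in_C delta_add delta_mult delta_minus intro: C_comm)

lemma delta_u_power: "\<delta> (u ^ m) = of_nat m * u ^ m"
proof (induction m)
  case (Suc m)
  have "\<delta> (u ^ Suc m) = u * u ^ m + u * (of_nat m * u ^ m)"
    by (simp add: delta_mult delta_u Suc)
  also have "\<dots> = of_nat (Suc m) * u ^ Suc m"
    by (simp add: distrib_right mult.assoc [symmetric] u_central [of "of_nat m"])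
  finally show ?case .
qed simp

text \<open>The u^i are eigenvectors for distinct eigenvalues. Subtracting the derivative of a
  relation from k times the relation removes u^k and multiplies the other coefficients by k - i,
  which is nonzero in \<open>D\<close> since k < p.\<close>

lemma u_powers_independent:
  assumes "k \<le> p" "\<And>i. i < k \<Longrightarrow> a i \<in> F" "(\<Sum>i<k. a i * u ^ i) =
      0" "i < k"
  shows "a i = 0"
  using assms
proof (induction k arbitrary: a i)
  case (Suc k)
  let ?s = "\<lambda>a k. \<Sum>i<k. a i * u ^ i"
  have "(\<Sum>i<Suc k. a i * (of_nat i * u ^ i)) = \<delta> (?s a (Suc k))"
    using Suc.prems(2) by (simp add: delta_sum delta_add delta_mult delta_u_power delta_F)
  then have "(\<Sum>i<Suc k. a i * (of_nat i * u ^ i)) = 0"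
    using Suc.prems(3) by simp
  moreover have "(\<Sum>i<Suc k. a i * (of_nat k * u ^ i)) = of_nat k * ?s a (Suc k)"
    unfolding sum_distrib_left by (rule sum.cong) (simp, metis mult.assoc mult_of_nat_commute)
  then have "(\<Sum>i<Suc k. a i * (of_nat k * u ^ i)) = 0"
    using Suc.prems(3) by simp
  ultimately have "(\<Sum>i<Suc k. a i * (of_nat k * u ^ i) - a i * (of_nat i * u ^ i)) = 0"
    by (simp add: sum_subtractf del: sum.lessThan_Suc)
  then have "?s (\<lambda>i. a i * of_nat (k - i)) k = 0"
    by (simp add: of_nat_diff left_diff_distrib right_diff_distrib mult.assoc)
  moreover have "a i * of_nat (k - i) \<in> F" if "i < k" for i
    using Suc.prems(2) [of i] that
      by (simp add: F_eq mult_in_C of_nat_in_C delta_mult del: of_nat_diff)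
  ultimately have "a i * of_nat (k - i) = 0" if "i < k" for i
    using Suc.IH [of "\<lambda>i. a i * of_nat (k - i)" i] Suc.prems(1) that
      by (simp del: of_nat_diff)
  moreover have "(of_nat (k - i) :: 'a) \<noteq> 0" if "i < k" for i
    using that Suc.prems(1) CHAR
      by (auto simp: of_nat_eq_0_iff_char_dvd simp del: of_nat_diff dest!: dvd_imp_le)
  ultimately have less: "a i = 0" if "i < k" for i using that by auto
  then have "a k = 0" using Suc.prems(3) u_nz by simp
  with less show ?case using Suc.prems(4) by (metis less_antisym)
qed simp

lemma fermat_of_nat:
  assumes "0 < i" "i < p"
  shows "(of_nat i :: 'a) ^ (p - 1) = 1"
proof -
  have "[i ^ (p - 1) = 1] (mod p)"
    using assms prime_p by (intro fermat_theorem) (auto dest: dvd_imp_le)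
  then have "(of_nat (i ^ (p - 1)) :: 'a) = of_nat 1"
    using CHAR by (simp only: of_nat_eq_iff_cong_CHAR)
  then show ?thesis by simp
qed

lemma power_sum_of_nat:
  assumes "0 < k" "Suc k < p"
  shows "(\<Sum>i=1..<p. (of_nat i :: 'a) ^ k) = 0"
proof -
  have "(of_int (\<Sum>i<p. int i ^ k) :: 'a) = 0"
    using prime_dvd_power_sum [OF prime_p assms(2)] CHAR
    by (metis dvd_def of_int_mult of_int_of_nat_eq of_nat_CHAR mult_zero_left)
  then have "(\<Sum>i<p. (of_nat i :: 'a) ^ k) = 0" by simp
  then show ?thesis
    using assms p_pos by (simp add: lessThan_atLeast0 sum.atLeast_Suc_lessThan [of 0 p] zero_power)
qed

text \<open>As T^p - T has p distinct roots in the prime field, \<open>C\<close> is the sum of the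
  eigenspaces of \<open>\<delta>\<close>; an eigenvector for i divided by u^i is a constant of
  \<open>\<delta>\<close>.\<close>

lemma u_power_expansion:
  assumes c: "c \<in> C"
  shows "\<exists>a. (\<forall>i. a i \<in> F) \<and> c = (\<Sum>i<p. a i * u ^ i)"
proof -
  \<comment> \<open>Up to sign, \<open>w i\<close> is the component of \<open>c\<close> in the eigenspace of \<open>\<delta>\<close> for the eigenvalue \<open>i\<close>.\<close>
  define w where "w i = (\<Sum>j=1..<p. of_nat i ^ (p - 1 - j) * (\<delta> ^^ j) c)" for i
  have delta_w: "\<delta> (w i) = of_nat i * w i" if i: "0 < i" "i < p" for i
  proof -
    let ?b = "\<lambda>j. of_nat i ^ (p - j) * (\<delta> ^^ j) c"
    have \<delta>_pow: "\<delta> (of_nat i ^ m * x) = of_nat i ^ m * \<delta> x" for m x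
      using delta_of_nat_mult [of "i ^ m" x] by simp
    have "\<delta> (w i) = (\<Sum>j=1..<p. ?b (Suc j))"
      unfolding w_def delta_sum by (rule sum.cong) (auto simp: \<delta>_pow)
    moreover have "of_nat i * w i = (\<Sum>j=1..<p. ?b j)"
      unfolding w_def sum_distrib_left
    proof (rule sum.cong)
      fix j assume "j \<in> {1..<p}"
      then have "p - j = Suc (p - 1 - j)" by auto
      then show "of_nat i * (of_nat i ^ (p - 1 - j) * (\<delta> ^^ j) c) = ?b j"
        by (simp add: mult.assoc)
    qed simp
    \<comment> \<open>The sum telescopes, and its end terms cancel by \<open>delta_p\<close> and
      Fermat's little theorem.\<close>
    ultimately have "\<delta> (w i) - of_nat i * w i = (\<Sum>j=1..<p. ?b (Suc j) - ?b j)"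
      by (simp only: sum_subtractf)
    also have "\<dots> = ?b p - ?b 1"
      using p_pos by (subst sum_Suc_diff') auto
    also have "\<dots> = 0"
      using fermat_of_nat [OF i] by (simp add: delta_p)
    finally show ?thesis by simp
  qed
  have w_C: "w i \<in> C" for i
    unfolding w_def using c
    by (intro sum_in_C mult_in_C delta_funpow_in_C power_in_C of_nat_in_C)
  \<comment> \<open>The power sums over i vanish except for j = p - 1, where the exponent is 0 and
    the sum is p - 1 = -1.\<close>
  have "(\<Sum>i=1..<p. w i) =
      (\<Sum>j=1..<p. (\<Sum>i=1..<p. of_nat i ^ (p - 1 - j)) * (\<delta> ^^ j) c)"
    unfolding w_def by (subst sum.swap) (simp add: sum_distrib_right)
  also have "\<dots> = (\<Sum>j\<in>{p - 1}. (\<Sum>i=1..<p. of_nat i ^ (p - 1 - j)) * (\<delta> ^^ j) c)"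
  proof (rule sum.mono_neutral_right)
    show "\<forall>j\<in>{1..<p} - {p - 1}. (\<Sum>i=1..<p. of_nat i ^ (p - 1 - j)) * (\<delta> ^^ j) c = 0"
    proof
      fix j assume "j \<in> {1..<p} - {p - 1}"
      then have "0 < p - 1 - j" "Suc (p - 1 - j) < p" by auto
      then show "(\<Sum>i=1..<p. of_nat i ^ (p - 1 - j)) * (\<delta> ^^ j) c = 0"
        by (simp only: power_sum_of_nat mult_zero_left)
    qed
  qed (use p_gt_1 in auto)
  also have "\<dots> = - (\<delta> ^^ (p - 1)) c"
    using CHAR p_pos of_nat_CHAR [where 'a = 'a] by (simp add: of_nat_diff)
  finally have sum_w: "(\<Sum>i=1..<p. w i) = - (\<delta> ^^ (p - 1)) c" .
  \<comment> \<open>The entry at 0 is the part of \<open>c\<close> killed by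
    \<open>\<delta>\<close>. The value 0 beyond \<open>p\<close> keeps \<open>a i\<close> in
    \<open>F\<close> for every index.\<close>
  define a where "a i = (if i =
      0 then c - (\<delta> ^^ (p - 1)) c else if i < p then - w i * inverse u ^ i else 0)" for i
  have "a i \<in> F" for i
  proof -
    consider "i = 0" | "0 < i" "i < p" | "p \<le> i" "0 < i" by linarith
    then show ?thesis
    proof cases
      case 1
      have "(\<delta> ^^ Suc (p - 1)) c = \<delta> c" using p_pos delta_p [of c] by simp
      with 1 show ?thesis using c
        by (simp add: a_def F_eq delta_funpow_in_C diff_in_C delta_diff)
    next
      case 2
      define y where "y = w i * inverse u ^ i"
      have y: "y * u ^ i = w i"
        using u_nz by (simp add: y_def mult.assoc left_right_inverse_power)
      have "\<delta> y * u ^ i + y * (of_nat i * u ^ i) = of_nat i * (y * u ^ i)"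
        using delta_w [OF 2] unfolding y [symmetric] delta_mult delta_u_power .
      moreover have "y * (of_nat i * u ^ i) = of_nat i * (y * u ^ i)"
        by (metis mult.assoc mult_of_nat_commute)
      ultimately have "\<delta> y = 0" using u_nz by simp
      moreover have "y \<in> C"
        unfolding y_def by (intro mult_in_C w_C power_in_C inverse_in_C u_in_C)
      moreover have "a i = - y" using 2 by (simp add: a_def y_def)
      ultimately show ?thesis by (simp add: F_eq minus_in_C delta_minus)
    next
      case 3
      then show ?thesis by (simp add: a_def F_eq C_iff)
    qed
  qed
  moreover have "c = (\<Sum>i<p. a i * u ^ i)"
  proof -
    have "a i * u ^ i = - w i" if "i \<in> {1..<p}" for i
      using that u_nz by (simp add: a_def mult.assoc left_right_inverse_power)
    then have "(\<Sum>i=1..<p. a i * u ^ i) = - (\<Sum>i=1..<p. w i)"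
      by (simp add: sum_negf)
    then have "(\<Sum>i<p. a i * u ^ i) = a 0 + (\<delta> ^^ (p - 1)) c"
      using p_pos sum_w by (simp add: lessThan_atLeast0 sum.atLeast_Suc_lessThan [of 0 p])
    then show ?thesis by (simp add: a_def)
  qed
  ultimately show ?thesis by blast
qed

lemma dimension_F_C: "ring.dimension ring_of_type_algebra p F C"
proof -
  let ?R = "ring_of_type_algebra :: 'a ring"
  interpret R: ring ?R by (rule ring_ring_of_type_algebra)
  define E where "E k = {\<Sum>i<k. a i * u ^ i | a. \<forall>i. a i \<in> F}" for k
  have F0: "0 \<in> F" using delta_0 by (simp add: F_eq C_iff)
  have F1: "- 1 \<in> F" by (simp add: F_eq C_iff delta_minus)
  have "R.dimension k F (E k)" if "k \<le> p" for k
    using that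
  proof (induction k)
    case 0
    have "E 0 = {\<zero>\<^bsub>?R\<^esub>}" using F0 by (auto simp: E_def ring_of_type_algebra_def)
    then show ?case by simp
  next
    case (Suc k)
    have "u ^ k \<notin> E k"
    proof
      assume "u ^ k \<in> E k"
      then obtain a where a: "\<forall>i. a i \<in> F" "u ^ k = (\<Sum>i<k. a i * u ^ i)"
        by (auto simp: E_def)
      \<comment> \<open>The coefficient -1 turns membership of u^k in the span into a vanishing
        relation of length \<open>Suc k\<close>.\<close>
      let ?a = "a(k := - 1)"
      have "?a k = 0"
        by (rule u_powers_independent [of "Suc k"]) (use a Suc.prems F1 in auto)
      then show False by simp
    qed
    then have "R.dimension (Suc k) F (R.line_extension F (u ^ k) (E k))"
      using Suc by (intro R.Suc_dim) (auto simp: ring_of_type_algebra_def)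
    moreover have "R.line_extension F (u ^ k) (E k) = E (Suc k)"
    proof (intro equalityI subsetI)
      fix x assume "x \<in> R.line_extension F (u ^ k) (E k)"
      then obtain b a where "b \<in> F" "\<forall>i. a i \<in> F" "x =
          b * u ^ k + (\<Sum>i<k. a i * u ^ i)"
        unfolding R.line_extension_mem_iff by (auto simp: E_def ring_of_type_algebra_def)
      then show "x \<in> E (Suc k)"
        unfolding E_def by (intro CollectI exI [of _ "a(k := b)"]) (auto simp: add.commute)
    next
      fix x assume "x \<in> E (Suc k)"
      then obtain a where "\<forall>i. a i \<in> F" "x = a k * u ^ k + (\<Sum>i<k. a i * u ^ i)"
        by (auto simp: E_def add.commute)
      then show "x \<in> R.line_extension F (u ^ k) (E k)"
        unfolding R.line_extension_mem_iff by (auto simp: E_def ring_of_type_algebra_def)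
    qed
    ultimately show ?case by simp
  qed
  moreover have "E p = C"
    using u_power_expansion F_subset_C
    by (auto simp: E_def intro!: sum_in_C mult_in_C power_in_C u_in_C)
  ultimately show ?thesis by (metis order_refl)
qed

end

subsection \<open>Petit algebras\<close>

context artin_schreier_derivation
begin

section \<open>Remainders modulo t^p - t - d\<close>

abbreviation petit_mod :: "'a \<Rightarrow> 'a poly \<Rightarrow> 'a poly" where
  "petit_mod d h \<equiv> mod_right \<delta> h (petit_poly d)"

lemma degree_petit_mod: "degree (petit_mod d h) < p"
  using mod_right_degree [OF petit_poly_nz, of h d] p_pos by (auto simp: degree_petit_poly)

lemma right_dvd_petit_mod: "right_dvd (petit_poly d) (h - petit_mod d h)"
  by (rule mod_right_dvd [OF petit_poly_nz])

lemma petit_mod_eqI: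
  "degree r < p \<Longrightarrow> right_dvd (petit_poly d) (h - r) \<Longrightarrow> petit_mod d h =
      r"
  by (rule mod_right_eqI [OF petit_poly_nz]) (simp_all add: degree_petit_poly)

lemma petit_mod_id: "degree h < p \<Longrightarrow> petit_mod d h = h"
  by (rule petit_mod_eqI) simp_all

lemma petit_mod_eq_iff:
  "petit_mod d h = petit_mod d k \<longleftrightarrow> right_dvd (petit_poly d) (h - k)"
proof
  assume "petit_mod d h = petit_mod d k"
  then show "right_dvd (petit_poly d) (h - k)"
    using right_dvd_diff [OF right_dvd_petit_mod [of d h] right_dvd_petit_mod [of d k]] by simp
next
  assume "right_dvd (petit_poly d) (h - k)"
  then show "petit_mod d h = petit_mod d k"
    using right_dvd_add [OF _ right_dvd_petit_mod [of d k], of "h - k"]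
    by (intro petit_mod_eqI degree_petit_mod) simp
qed

text \<open>Multiples of \<open>f\<close> form a left ideal, so a right factor may be reduced first.
  For left factors this can fail, which is how associativity of S_f is lost.\<close>

lemma petit_mod_cong_left_mult: "petit_mod d (h \<star> petit_mod d k) = petit_mod d (h \<star> k)"
  using right_dvd_diff_mult [OF right_dvd_petit_mod [of d k], of h]
  by (subst eq_commute) (simp add: petit_mod_eq_iff diff_mult_diff_right)

lemma petit_mod_add: "petit_mod d (h + k) = petit_mod d h + petit_mod d k"
proof (rule petit_mod_eqI)
  show "degree (petit_mod d h + petit_mod d k) < p"
    by (intro degree_add_less degree_petit_mod)
  show "right_dvd (petit_poly d) (h + k - (petit_mod d h + petit_mod d k))"
    using right_dvd_add [OF right_dvd_petit_mod [of d h] right_dvd_petit_mod [of d k]]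
    by (simp add: algebra_simps)
qed

lemma degree_lscale_less: "degree h < p \<Longrightarrow> degree ([:a:] \<star> h) < p"
  using degree_diff_mult_le [of "[:a:]" h] by simp

lemma petit_mod_lscale: "petit_mod d ([:a:] \<star> h) = [:a:] \<star> petit_mod d h"
proof (rule petit_mod_eqI)
  show "degree ([:a:] \<star> petit_mod d h) < p"
    by (rule degree_lscale_less [OF degree_petit_mod])
  show "right_dvd (petit_poly d) ([:a:] \<star> h - [:a:] \<star> petit_mod d h)"
    using right_dvd_diff_mult [OF right_dvd_petit_mod [of d h], of "[:a:]"]
    by (simp only: diff_mult_diff_right)
qed

lemma petit_algebra_simps:
  "carrier (petit_algebra \<delta> (petit_poly d)) = {h. degree h < p}"
  "h \<otimes>\<^bsub>petit_algebra \<delta> (petit_poly d)\<^esub> k = petit_mod d (h \<star> k)"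
  "\<one>\<^bsub>petit_algebra \<delta> (petit_poly d)\<^esub> = [:1:]"
  "\<zero>\<^bsub>petit_algebra \<delta> (petit_poly d)\<^esub> = 0"
  "h \<oplus>\<^bsub>petit_algebra \<delta> (petit_poly d)\<^esub> k = h + k"
  "a \<odot>\<^bsub>petit_algebra \<delta> (petit_poly d)\<^esub> h = [:a:] \<star> h"
  by (simp_all add: petit_algebra_def diff_poly_ring_def degree_petit_poly)

lemma diff_poly_ring_simps:
  "carrier (diff_poly_ring \<delta>) = UNIV"
  "h \<otimes>\<^bsub>diff_poly_ring \<delta>\<^esub> k = h \<star> k"
  "\<one>\<^bsub>diff_poly_ring \<delta>\<^esub> = [:1:]"
  "\<zero>\<^bsub>diff_poly_ring \<delta>\<^esub> = 0"
  "h \<oplus>\<^bsub>diff_poly_ring \<delta>\<^esub> k = h + k"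
  by (simp_all add: diff_poly_ring_def)

end

context central_artin_schreier
begin

abbreviation base_field :: "'a ring" where
  "base_field \<equiv> ring_of_type_algebra\<lparr>carrier := F\<rparr>"

lemma field_base_field: "field base_field"
  by (rule ring.subfield_iff(2) [OF ring_ring_of_type_algebra subfield_F])

text \<open>Elements of \<open>F\<close> commute with \<open>D\<close> because they are central, and
  with t because \<open>\<delta>\<close> kills them. This makes left multiplications in S_f linear
  over \<open>F\<close>.\<close>

lemma F_const_central:
  assumes "a \<in> F"
  shows "h \<star> [:a:] = [:a:] \<star> h"
proof (induction h)
  case (pCons b h)
  have t: "[:0, 1:] \<star> [:a:] = [:a:] \<star> [:0, 1:]"
    using assms by (simp add: diff_mult_t t_times_pCons delta_F map_poly_pCons)
  have b: "[:b:] \<star> [:a:] = [:a:] \<star> [:b:]"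
    using assms F_subset_C C_comm [of a b] by (auto simp: map_poly_pCons)
  have "pCons b h \<star> [:a:] = [:b:] \<star> [:a:] + h \<star> ([:0, 1:] \<star> [:a:])"
    by (simp only: pCons_eq_diff_mult [of b h] diff_mult_add_left diff_mult_assoc)
  also have "\<dots> = [:a:] \<star> [:b:] + h \<star> [:a:] \<star> [:0, 1:]"
    by (simp only: t b diff_mult_assoc)
  also have "\<dots> = [:a:] \<star> pCons b h"
    by (simp only: pCons_eq_diff_mult [of b h] pCons.IH diff_mult_add_right diff_mult_assoc)
  finally show ?case .
qed simp

lemma nonassoc_algebra_petit: "nonassoc_algebra base_field (petit_algebra \<delta> (petit_poly d))"
proof -
  have cring: "cring base_field"
    using field_base_field by (simp add: field_def domain_def)
  have group: "abelian_group (petit_algebra \<delta> (petit_poly d))"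
  proof (rule abelian_groupI)
    fix x assume "x \<in> carrier (petit_algebra \<delta> (petit_poly d))"
    then show "\<exists>y\<in>carrier (petit_algebra \<delta> (petit_poly d)).
        y \<oplus>\<^bsub>petit_algebra \<delta> (petit_poly d)\<^esub> x = \<zero>\<^bsub>petit_algebra \<delta> (petit_poly d)\<^esub>"
      by (intro bexI [of _ "- x"]) (simp_all add: petit_algebra_simps)
  qed (use p_pos in \<open>simp_all add: petit_algebra_simps degree_add_less algebra_simps\<close>)
  have module: "module base_field (petit_algebra \<delta> (petit_poly d))"
    by (rule moduleI [OF cring group])
      (simp_all add: petit_algebra_simps degree_lscale_less diff_mult_add_right ring_of_type_algebra_def
        map_poly_add_times map_poly_times_times map_poly_times_add
        del: diff_mult_const, simp_all add: map_poly_add_times map_poly_times_times)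
  show ?thesis
  proof (rule nonassoc_algebra.intro [OF module nonassoc_algebra_axioms.intro])
    fix k x y assume *: "k \<in> carrier base_field"
      "x \<in> carrier (petit_algebra \<delta> (petit_poly d))" "y \<in> carrier (petit_algebra \<delta> (petit_poly d))"
    then have k: "k \<in> F" by simp
    show "k \<odot>\<^bsub>petit_algebra \<delta> (petit_poly d)\<^esub> x \<otimes>\<^bsub>petit_algebra \<delta> (petit_poly d)\<^esub> y =
        k \<odot>\<^bsub>petit_algebra \<delta> (petit_poly d)\<^esub> (x \<otimes>\<^bsub>petit_algebra \<delta> (petit_poly d)\<^esub> y)"
      by (simp only: petit_algebra_simps diff_mult_assoc petit_mod_lscale)
    have "x \<star> ([:k:] \<star> y) = [:k:] \<star> (x \<star> y)"
      by (simp only: diff_mult_assoc [symmetric] F_const_central [OF k])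
    then show "x \<otimes>\<^bsub>petit_algebra \<delta> (petit_poly d)\<^esub> (k \<odot>\<^bsub>petit_algebra \<delta> (petit_poly d)\<^esub> y) =
        k \<odot>\<^bsub>petit_algebra \<delta> (petit_poly d)\<^esub> (x \<otimes>\<^bsub>petit_algebra \<delta> (petit_poly d)\<^esub> y)"
      by (simp only: petit_algebra_simps petit_mod_lscale)
  qed (use field_base_field p_pos in
      \<open>simp_all add: petit_algebra_simps degree_petit_mod petit_mod_add petit_mod_id
         diff_mult_add_left diff_mult_add_right diff_mult_1_right\<close>)
qed

section \<open>The dimension of S_f over \<open>F\<close>\<close>

text \<open>S_f need not be a ring, so its dimension is measured inside the associative ring
  \<open>D[t;\<delta>]\<close>, with \<open>F\<close> embedded as constants; the scalar action is
  the same.\<close>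

abbreviation const_F :: "'a poly set" where
  "const_F \<equiv> (\<lambda>a. [:a:]) ` F"

lemma subfield_const_F: "subfield const_F (diff_poly_ring \<delta>)"
proof -
  have hom: "ring_hom_ring (ring_of_type_algebra :: 'a ring) (diff_poly_ring \<delta>) (\<lambda>a. [:a:])"
    by (rule ring_hom_ringI [OF ring_ring_of_type_algebra ring_diff_poly_ring])
      (simp_all add: diff_poly_ring_simps ring_of_type_algebra_def map_poly_pCons)
  show ?thesis
    by (rule ring_hom_ring.img_is_subfield(2) [OF hom subfield_F]) (simp add: diff_poly_ring_simps)
qed

text \<open>Each of the k summands D t^i contributes N. The bound is put on coefficients rather than
  on \<open>degree\<close> so that k = 0 describes the zero space.\<close>

lemma dimension_low_degree:
  assumes "ring.dimension ring_of_type_algebra N F UNIV"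
  shows "ring.dimension (diff_poly_ring \<delta>) (k * N) const_F {h. \<forall>i\<ge>k. coeff h i =
      0}"
proof (induction k)
  case 0
  have "{h. \<forall>i\<ge>0. coeff h i = 0} = {\<zero>\<^bsub>diff_poly_ring \<delta>\<^esub>}"
    by (auto simp: poly_eq_iff diff_poly_ring_simps)
  then show ?case
    using ring.zero_dim [OF ring_diff_poly_ring] by simp
next
  case (Suc k)
  let ?P = "\<lambda>k. {h :: 'a poly. \<forall>i\<ge>k. coeff h i = 0}"
  let ?M = "range (\<lambda>a :: 'a. monom a k)"
  have "inj (\<lambda>a :: 'a. monom a k)" by (auto simp: inj_def)
  then have "ring.dimension (diff_poly_ring \<delta>) N const_F ?M"
    using assms
    by (intro dimension_linear_image [OF ring_ring_of_type_algebra ring_diff_poly_ring subfield_F])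
      (auto simp: diff_poly_ring_simps ring_of_type_algebra_def add_monom map_poly_monom)
  moreover have "?P k \<inter> ?M = {\<zero>\<^bsub>diff_poly_ring \<delta>\<^esub>}"
    by (auto simp: diff_poly_ring_simps image_iff intro: exI [of _ 0])
  ultimately have "ring.dimension (diff_poly_ring \<delta>) (k * N + N) const_F (?P k <+>\<^bsub>diff_poly_ring \<delta>\<^esub> ?M)"
    using Suc by (intro ring.dimension_direct_sum_space [OF ring_diff_poly_ring subfield_const_F])
  moreover have "?P k <+>\<^bsub>diff_poly_ring \<delta>\<^esub> ?M = ?P (Suc k)"
  proof (intro equalityI subsetI)
    fix h assume "h \<in> ?P k <+>\<^bsub>diff_poly_ring \<delta>\<^esub> ?M"
    then show "h \<in> ?P (Suc k)"
      by (auto simp: set_add_def' diff_poly_ring_simps)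
  next
    fix h assume h: "h \<in> ?P (Suc k)"
    have "coeff (h - monom (coeff h k) k) i = 0" if "k \<le> i" for i
      using h that by (cases "i = k") auto
    then have "h - monom (coeff h k) k \<in> ?P k" by blast
    moreover have "h = (h - monom (coeff h k) k) + monom (coeff h k) k" by simp
    ultimately show "h \<in> ?P k <+>\<^bsub>diff_poly_ring \<delta>\<^esub> ?M"
      unfolding set_add_def' diff_poly_ring_simps by blast
  qed
  ultimately show ?case by (simp add: add.commute)
qed

text \<open>The tower law gives [D:F] = m p, and S_f has p coefficients in \<open>D\<close>.\<close>

lemma dimension_petit:
  assumes "ring.dimension ring_of_type_algebra m C UNIV" "subfield C ring_of_type_algebra"
  shows "ring.dimension (diff_poly_ring \<delta>) (m * p\<^sup>2) const_F {h. degree h < p}"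
proof -
  have "ring.dimension ring_of_type_algebra (p * m) F UNIV"
    using ring.telescopic_base [OF ring_ring_of_type_algebra subfield_F assms(2) dimension_F_C assms(1)] .
  then have "ring.dimension (diff_poly_ring \<delta>) (p * (p * m)) const_F {h. \<forall>i\<ge>p. coeff h i = 0}"
    by (rule dimension_low_degree)
  moreover have "{h :: 'a poly. \<forall>i\<ge>p. coeff h i = 0} = {h. degree h < p}"
    using p_pos by (auto simp: coeff_eq_0 intro: degree_lessI)
  ultimately show ?thesis by (simp add: power2_eq_square ac_simps)
qed

section \<open>The division property\<close>

text \<open>Intended for multiplication maps of S_f. The image has the same finite dimension as the
  space containing it, so it is the whole space.\<close>

lemma petit_linear_injective_imp_bij:
  assumes dim: "ring.dimension (diff_poly_ring \<delta>) N const_F {h. degree h < p}"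
    and closed: "\<And>h. degree (\<phi> h) < p"
    and add: "\<And>h k. \<phi> (h + k) = \<phi> h + \<phi> k"
    and scale: "\<And>a h. a \<in> F \<Longrightarrow> \<phi> ([:a:] \<star> h) =
        [:a:] \<star> \<phi> h"
    and ker: "\<And>h. degree h < p \<Longrightarrow> \<phi> h = 0 \<Longrightarrow> h = 0"
  shows "bij_betw \<phi> {h. degree h < p} {h. degree h < p}"
proof -
  let ?E = "{h :: 'a poly. degree h < p}"
  have \<phi>_diff: "\<phi> (h - k) = \<phi> h - \<phi> k" for h k
    using add [of "h - k" k] by simp
  have inj: "inj_on \<phi> ?E"
  proof (rule inj_onI)
    fix h k assume "h \<in> ?E" "k \<in> ?E" "\<phi> h = \<phi> k"
    then show "h = k" using ker [of "h - k"] \<phi>_diff [of h k] by (simp add: degree_diff_less)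
  qed
  have "ring.dimension (diff_poly_ring \<delta>) N ((\<lambda>x. x) ` const_F) (\<phi> ` ?E)"
    using dim inj
    by (intro dimension_linear_image [OF ring_diff_poly_ring ring_diff_poly_ring subfield_const_F])
      (auto simp: diff_poly_ring_simps add scale simp del: diff_mult_const)
  then have "\<phi> ` ?E = ?E"
    using closed
      by (intro ring.dimension_subspace_eq [OF ring_diff_poly_ring subfield_const_F dim]) auto
  with inj show ?thesis by (simp add: bij_betw_def)
qed

text \<open>A factorisation f = q (t - z) is a zero product of two nonzero elements of S_f.
  Conversely, without zero divisors the multiplication maps are injective and linear over
  \<open>F\<close>, hence bijective.\<close>

lemma is_division_algebra_petit:
  assumes dim: "ring.dimension (diff_poly_ring \<delta>) N const_F {h. degree h < p}"
  shows "is_division_algebra (petit_algebra \<delta> (petit_poly d)) \<longleftrightarrow>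
      (\<forall>z. d \<noteq> V_map \<delta> p z - z)"
proof (intro iffI allI notI)
  fix z assume div: "is_division_algebra (petit_algebra \<delta> (petit_poly d))" and "d =
      V_map \<delta> p z - z"
  then have "right_dvd [:- z, 1:] (petit_poly d)"
    by (simp only: right_dvd_linear_iff)
  then obtain q where q: "petit_poly d = q \<star> [:- z, 1:]" by (rule right_dvdE)
  have q_nz: "q \<noteq> 0" using q petit_poly_nz [of d] by auto
  have deg_q: "degree q < p"
    using degree_diff_mult [OF q_nz, of "[:- z, 1:]"] q degree_petit_poly [of d] by simp
  have "petit_mod d (q \<star> [:- z, 1:]) = 0"
    using p_pos by (intro petit_mod_eqI) (simp_all add: q [symmetric] right_dvd_refl)
  moreover have "petit_mod d (q \<star> 0) = 0"
    using p_pos by (simp add: petit_mod_id)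
  moreover have inj: "inj_on (\<lambda>x. petit_mod d (q \<star> x)) {h. degree h < p}"
    using div q_nz deg_q by (auto simp: is_division_algebra_def petit_algebra_simps bij_betw_def)
  ultimately have "[:- z, 1:] = 0"
    using p_gt_1 inj_onD [OF inj, of "[:- z, 1:]" 0] by simp
  then show False by simp
next
  assume "\<forall>z. d \<noteq> V_map \<delta> p z - z"
  then have no_zero_divisors: "h = 0 \<or> k = 0"
    if "degree h < p" "degree k < p" "petit_mod d (h \<star> k) = 0" for h k
    using that right_dvd_petit_mod [of d "h \<star> k"] petit_poly_no_zero_divisors [of d h k]
      by simp
  have "{h :: 'a poly. degree h < p} \<noteq> {0}"
    using p_pos by (auto simp: set_eq_iff intro: exI [of _ "[:1:]"])
  moreover have "bij_betw (\<lambda>x. petit_mod d (a \<star> x)) {h. degree h < p} {h. degree h < p}"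
    if "degree a < p" "a \<noteq> 0" for a
  proof (rule petit_linear_injective_imp_bij [OF dim])
    fix b h assume b: "b \<in> F"
    have "a \<star> ([:b:] \<star> h) = [:b:] \<star> (a \<star> h)"
      by (simp only: diff_mult_assoc [symmetric] F_const_central [OF b])
    then show "petit_mod d (a \<star> ([:b:] \<star> h)) = [:b:] \<star> petit_mod d (a \<star> h)"
      by (simp only: petit_mod_lscale)
  qed (use that no_zero_divisors in \<open>auto simp: degree_petit_mod diff_mult_add_right petit_mod_add\<close>)
  moreover have "bij_betw (\<lambda>x. petit_mod d (x \<star> a)) {h. degree h < p} {h. degree h < p}"
    if "degree a < p" "a \<noteq> 0" for a
  proof (rule petit_linear_injective_imp_bij [OF dim])
    fix b h
    show "petit_mod d ([:b:] \<star> h \<star> a) = [:b:] \<star> petit_mod d (h \<star> a)"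
      by (simp only: diff_mult_assoc petit_mod_lscale)
  qed (use that no_zero_divisors in \<open>auto simp: degree_petit_mod diff_mult_add_left petit_mod_add\<close>)
  ultimately show "is_division_algebra (petit_algebra \<delta> (petit_poly d))"
    by (simp add: is_division_algebra_def petit_algebra_simps)
qed

section \<open>Associativity\<close>

lemma petit_poly_central:
  "d \<in> F \<Longrightarrow> petit_poly d \<star> h = h \<star> petit_poly d"
  by (simp only: petit_poly_def diff_mult_diff_left diff_mult_diff_right gamma_central F_const_central)

text \<open>Associate t^(p-1), t and x. One bracketing reduces t^p to t^p - f before multiplying by
  x, the other amounts to t^p x; their difference is f x.\<close>

lemma associative_petit_imp_right_dvd:
  assumes assoc: "is_associative_algebra (petit_algebra \<delta> (petit_poly d))" and "degree x < p"
  shows "right_dvd (petit_poly d) (petit_poly d \<star> x)"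
proof -
  let ?s = "monom (1::'a) (p - 1)" and ?t = "[:0, 1:] :: 'a poly"
  have st: "?s \<star> ?t = monom 1 p"
    using p_pos by (simp add: diff_mult_right_t flip: monom_Suc)
  have "degree (monom 1 p - petit_poly d) < p"
  proof (rule degree_lessI)
    show "monom 1 p - petit_poly d \<noteq> 0 \<or> 0 < p" using p_pos by simp
    show "\<forall>k\<ge>p. coeff (monom 1 p - petit_poly d) k = 0"
      using p_gt_1 by (auto simp: petit_poly_defs coeff_pCons split: nat.split)
  qed
  then have mod: "petit_mod d (?s \<star> ?t) = monom 1 p - petit_poly d"
    unfolding st by (rule petit_mod_eqI) (simp add: right_dvd_refl)
  have deg: "degree ?s < p" "degree ?t < p"
    using p_gt_1 by (auto simp: degree_monom_eq)
  have "petit_mod d (petit_mod d (?s \<star> ?t) \<star> x) =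
      petit_mod d (?s \<star> petit_mod d (?t \<star> x))"
    using assoc deg assms(2) by (simp add: is_associative_algebra_def petit_algebra_simps)
  also have "\<dots> = petit_mod d (monom 1 p \<star> x)"
    by (simp only: petit_mod_cong_left_mult st diff_mult_assoc [symmetric])
  finally have "right_dvd (petit_poly d) (monom 1 p \<star> x - (monom 1 p - petit_poly d) \<star> x)"
    unfolding mod by (simp only: petit_mod_eq_iff [symmetric])
  then show ?thesis by (simp add: diff_mult_diff_left)
qed

text \<open>Since t^p - t is central, f x - x f = x d - d x. For x constant or x = t this has degree
  below p and is divisible by \<open>f\<close>, so it is zero: \<open>d\<close> is central and
  \<open>\<delta> d = 0\<close>. Conversely, for d in \<open>F\<close> the polynomial
  \<open>f\<close> is central and S_f is a quotient by a two-sided ideal.\<close>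

lemma is_associative_algebra_petit:
  "is_associative_algebra (petit_algebra \<delta> (petit_poly d)) \<longleftrightarrow> d \<in> F"
proof
  assume assoc: "is_associative_algebra (petit_algebra \<delta> (petit_poly d))"
  have comm: "x \<star> [:d:] = [:d:] \<star> x"
    if x: "degree x < p" and small: "degree (x \<star> [:d:] - [:d:] \<star> x) < p" for x
  proof -
    have "right_dvd (petit_poly d) (petit_poly d \<star> x - x \<star> petit_poly d)"
      by (rule right_dvd_diff [OF associative_petit_imp_right_dvd [OF assoc x] right_dvdI [OF refl]])
    moreover have "petit_poly d \<star> x - x \<star> petit_poly d =
        x \<star> [:d:] - [:d:] \<star> x"
      by (simp only: petit_poly_def diff_mult_diff_left diff_mult_diff_right gamma_central) simp
    ultimately have "x \<star> [:d:] - [:d:] \<star> x = 0"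
      using small
        by (intro right_dvd_imp_eq_0 [of "petit_poly d"]) (simp_all only: degree_petit_poly simp_thms)
    then show ?thesis by simp
  qed
  have "d * a = a * d" for a
    using comm [of "[:a:]"] p_pos by (simp add: map_poly_pCons)
  moreover have "\<delta> d = 0"
    using comm [of "[:0, 1:]"] p_gt_1 by (simp add: diff_mult_t t_times_pCons map_poly_pCons)
  ultimately show "d \<in> F" by (simp add: F_eq C_iff)
next
  assume d: "d \<in> F"
  have "petit_mod d (petit_mod d (x \<star> y) \<star> z) =
      petit_mod d (x \<star> petit_mod d (y \<star> z))" for x y z
  proof -
    obtain q where q: "x \<star> y - petit_mod d (x \<star> y) = q \<star> petit_poly d"
      using right_dvd_petit_mod by (rule right_dvdE)
    have "x \<star> y \<star> z - petit_mod d (x \<star> y) \<star> z =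
        q \<star> petit_poly d \<star> z"
      by (simp only: diff_mult_diff_left [symmetric] q)
    also have "\<dots> = q \<star> z \<star> petit_poly d"
      by (simp only: diff_mult_assoc petit_poly_central [OF d])
    finally have "petit_mod d (x \<star> y \<star> z) =
        petit_mod d (petit_mod d (x \<star> y) \<star> z)"
      unfolding petit_mod_eq_iff by (rule right_dvdI)
    then show ?thesis by (simp only: petit_mod_cong_left_mult diff_mult_assoc)
  qed
  then show "is_associative_algebra (petit_algebra \<delta> (petit_poly d))"
    by (simp add: is_associative_algebra_def petit_algebra_simps)
qed

end

subsection \<open>Automorphisms\<close>

lemma group_algebra_Aut:
  fixes K and A (structure)
  assumes "nonassoc_algebra K A"
  shows "group (algebra_Aut K A)"
proof -
  interpret nonassoc_algebra K A by (rule assms)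
  have "subgroup (algebra_auts K A) (BijGroup (carrier A))"
  proof (rule subgroup.intro)
    show "algebra_auts K A \<subseteq> carrier (BijGroup (carrier A))"
      by (auto simp: algebra_auts_def BijGroup_def)
    show "\<one>\<^bsub>BijGroup (carrier A)\<^esub> \<in> algebra_auts K A"
      by (auto simp: algebra_auts_def BijGroup_def id_Bij hom_def m_closed)
  next
    fix \<phi> \<psi> assume *: "\<phi> \<in> algebra_auts K A" "\<psi> \<in> algebra_auts K A"
    then have Bij: "\<phi> \<in> Bij (carrier A)" "\<psi> \<in> Bij (carrier A)"
      by (auto simp: algebra_auts_def)
    then have "\<phi> \<otimes>\<^bsub>BijGroup (carrier A)\<^esub> \<psi> =
        compose (carrier A) \<phi> \<psi>"
      by (simp add: BijGroup_def)
    moreover have "compose (carrier A) \<phi> \<psi> \<in> algebra_auts K A"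
      using * compose_Bij [OF Bij] Bij_imp_funcset [OF Bij(1)] Bij_imp_funcset [OF Bij(2)]
      by (auto simp: algebra_auts_def hom_def m_closed compose_eq Pi_iff)
    ultimately show "\<phi> \<otimes>\<^bsub>BijGroup (carrier A)\<^esub> \<psi> \<in> algebra_auts K A" by simp
  next
    fix \<phi> assume *: "\<phi> \<in> algebra_auts K A"
    let ?\<psi> = "inv_into (carrier A) \<phi>"
    have Bij: "\<phi> \<in> Bij (carrier A)" using * by (simp add: algebra_auts_def)
    then have bij: "bij_betw \<phi> (carrier A) (carrier A)" by (simp add: Bij_def)
    have closed: "?\<psi> x \<in> carrier A" if "x \<in> carrier A" for x
      using Bij that by (rule Bij_inv_into_mem)
    have "?\<psi> (x \<otimes> y) =
        ?\<psi> x \<otimes> ?\<psi> y" if "x \<in> carrier A" "y \<in> carrier A" for x y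
      using * that m_closed
        by (intro Bij_inv_into_lemma [OF _ Bij]) (auto simp: algebra_auts_def hom_def)
    moreover have "?\<psi> (x \<oplus> y) =
        ?\<psi> x \<oplus> ?\<psi> y" if "x \<in> carrier A" "y \<in> carrier A" for x y
      using * that by (intro Bij_inv_into_lemma [OF _ Bij]) (auto simp: algebra_auts_def hom_def)
    moreover have "?\<psi> (k \<odot> x) =
        k \<odot> ?\<psi> x" if k: "k \<in> carrier K" and x: "x \<in> carrier A" for k x
    proof -
      have "k \<odot> x = \<phi> (k \<odot> ?\<psi> x)"
        using * k closed [OF x] bij_betw_inv_into_right [OF bij x] by (simp add: algebra_auts_def)
      then show ?thesis
        using bij_betw_inv_into_left [OF bij] k closed [OF x] by simp
    qed
    ultimately have "(\<lambda>x\<in>carrier A. ?\<psi> x) \<in> algebra_auts K A"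
      using restrict_inv_into_Bij [OF Bij] closed
      by (auto simp: algebra_auts_def hom_def m_closed)
    then show "inv\<^bsub>BijGroup (carrier A)\<^esub> \<phi> \<in> algebra_auts K A"
      by (simp add: inv_BijGroup [OF Bij])
  qed
  then show ?thesis
    unfolding algebra_Aut_def by (rule subgroup.subgroup_is_group) (rule group_BijGroup)
qed

context central_artin_schreier
begin

text \<open>\<open>conj_u\<close> preserves degrees, so the reduction in \<open>G_petit\<close> has
  no effect.\<close>

lemma G_petit_eq: "G_petit \<delta> (petit_poly d) = (\<lambda>h\<in>{h. degree h < p}. conj_u h)"
  by (auto simp: G_petit_def petit_algebra_simps G_id_minus1_eq_conj_u petit_mod_id intro!: restrict_ext)

text \<open>As \<open>f\<close> is fixed, \<open>conj_u\<close> preserves the left ideal of its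
  multiples; this gives compatibility with the product of S_f.\<close>

lemma conj_u_petit_mod: "conj_u (petit_mod d h) = petit_mod d (conj_u h)"
proof (rule sym, rule petit_mod_eqI)
  show "degree (conj_u (petit_mod d h)) < p" by (simp add: degree_petit_mod)
  obtain q where "h - petit_mod d h = q \<star> petit_poly d"
    using right_dvd_petit_mod by (rule right_dvdE)
  then have "conj_u h - conj_u (petit_mod d h) = conj_u q \<star> petit_poly d"
    by (metis conj_u_diff conj_u_mult conj_u_petit_poly)
  then show "right_dvd (petit_poly d) (conj_u h - conj_u (petit_mod d h))" by (rule right_dvdI)
qed

lemma conj_u_funpow: "(conj_u ^^ k) h = [:u ^ k:] \<star> h \<star> [:inverse u ^ k:]"
proof (induction k)
  case 0
  then show ?case by (simp add: diff_mult_1_right)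
next
  case (Suc k)
  have "[:u:] \<star> [:u ^ k:] = [:u ^ Suc k:]" by (simp add: map_poly_pCons)
  moreover have "[:inverse u ^ k:] \<star> [:inverse u:] = [:inverse u ^ Suc k:]"
    by (simp add: map_poly_pCons power_commutes)
  moreover have "(conj_u ^^ Suc k) h =
      [:u:] \<star> ([:u ^ k:] \<star> h \<star> [:inverse u ^ k:]) \<star> [:inverse u:]"
    by (simp only: funpow.simps o_apply Suc) (simp only: conj_u_def)
  then have "(conj_u ^^ Suc k) h =
      [:u:] \<star> [:u ^ k:] \<star> h \<star> ([:inverse u ^ k:] \<star> [:inverse u:])"
    by (simp only: diff_mult_assoc)
  ultimately show ?case by (simp only:)
qed

text \<open>The derivative of u^p is p u^p = 0, so u^p lies in \<open>F\<close> and conjugation by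
  it is trivial.\<close>

lemma conj_u_funpow_p: "(conj_u ^^ p) h = h"
proof -
  have "u ^ p \<in> F"
    using of_nat_CHAR [where 'a = 'a] CHAR by (simp add: F_eq power_in_C u_in_C delta_u_power)
  then have "(conj_u ^^ p) h = h \<star> ([:u ^ p:] \<star> [:inverse u ^ p:])"
    by (simp only: conj_u_funpow F_const_central [symmetric] diff_mult_assoc)
  also have "[:u ^ p:] \<star> [:inverse u ^ p:] = [:1:]"
    using u_nz by (simp add: map_poly_pCons left_right_inverse_power)
  finally show ?thesis by (simp add: diff_mult_1_right)
qed

lemma G_petit_automorphism:
  "G_petit \<delta> (petit_poly d) \<in> carrier (algebra_Aut base_field (petit_algebra \<delta> (petit_poly d)))"
proof -
  let ?E = "{h :: 'a poly. degree h < p}"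
  have funpow_degree: "degree ((conj_u ^^ k) h) = degree h" for k h
    by (induction k) simp_all
  have "bij_betw conj_u ?E ?E"
  \<comment> \<open>The inverse is the (p-1)-th iterate, because the p-th one is the
    identity.\<close>
  proof (rule bij_betw_byWitness [where f' = "conj_u ^^ (p - 1)"])
    have "(conj_u ^^ (p - 1)) (conj_u h) = (conj_u ^^ p) h"
      "conj_u ((conj_u ^^ (p - 1)) h) = (conj_u ^^ p) h" for h
      using p_pos by (cases p; simp add: funpow_swap1)+
    then show "\<forall>h\<in>?E. (conj_u ^^ (p - 1)) (conj_u h) =
        h" "\<forall>h\<in>?E. conj_u ((conj_u ^^ (p - 1)) h) = h"
      by (simp_all add: conj_u_funpow_p)
  qed (auto simp: funpow_degree)
  then have "restrict conj_u ?E \<in> Bij ?E"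
    by (simp add: Bij_def)
  moreover have "conj_u ([:a:] \<star> h) = [:a:] \<star> conj_u h" for a h
    by (simp only: conj_u_mult conj_u_const)
  ultimately show ?thesis
    by (auto simp: algebra_Aut_def algebra_auts_def G_petit_eq petit_algebra_simps hom_def
        degree_petit_mod degree_lscale_less conj_u_petit_mod conj_u_mult conj_u_add degree_add_less
        simp del: diff_mult_const)
qed

lemma card_generate_G_petit:
  "card (generate (algebra_Aut base_field (petit_algebra \<delta> (petit_poly d))) {G_petit \<delta> (petit_poly d)}) = p"
proof -
  let ?Aut = "algebra_Aut base_field (petit_algebra \<delta> (petit_poly d))" and ?G = "G_petit \<delta> (petit_poly d)"
  let ?E = "{h :: 'a poly. degree h < p}"
  interpret Aut: group ?Aut
    by (rule group_algebra_Aut [OF nonassoc_algebra_petit])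
  have one: "\<one>\<^bsub>?Aut\<^esub> = (\<lambda>h\<in>?E. h)"
    by (simp add: algebra_Aut_def BijGroup_def petit_algebra_simps)
  have mult: "\<phi> \<otimes>\<^bsub>?Aut\<^esub> \<psi> =
      compose ?E \<phi> \<psi>" if "\<phi> \<in> carrier ?Aut" "\<psi> \<in> carrier ?Aut" for \<phi> \<psi>
    using that by (simp add: algebra_Aut_def algebra_auts_def BijGroup_def petit_algebra_simps)
  have pow: "?G [^]\<^bsub>?Aut\<^esub> k = (\<lambda>h\<in>?E. (conj_u ^^ k) h)" for k :: nat
  proof (induction k)
    case (Suc k)
    have "?G [^]\<^bsub>?Aut\<^esub> Suc k = compose ?E (?G [^]\<^bsub>?Aut\<^esub> k) ?G"
      using G_petit_automorphism by (simp add: mult)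
    also have "\<dots> = (\<lambda>h\<in>?E. (conj_u ^^ Suc k) h)"
      unfolding Suc by (auto simp: G_petit_eq compose_def funpow_swap1 intro!: restrict_ext)
    finally show ?case .
  qed (simp add: one)
  have "?G [^]\<^bsub>?Aut\<^esub> p = \<one>\<^bsub>?Aut\<^esub>"
    by (simp add: pow one conj_u_funpow_p)
  then have "Aut.ord ?G dvd p"
    using G_petit_automorphism by (simp add: Aut.pow_eq_id)
  \<comment> \<open>\<open>G\<close> moves t, which lies in S_f as p > 1; an order dividing the
    prime \<open>p\<close> and different from 1 is \<open>p\<close>.\<close>
  moreover have "?G \<noteq> \<one>\<^bsub>?Aut\<^esub>"
  proof
    assume "?G = \<one>\<^bsub>?Aut\<^esub>"
    then have "?G [:0, 1:] = (\<lambda>h\<in>?E. h) [:0, 1:]" by (simp only: one)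
    then show False using p_gt_1 by (simp add: G_petit_eq conj_u_t)
  qed
  then have "Aut.ord ?G \<noteq> 1"
    using Aut.ord_eq_1 [OF G_petit_automorphism] by blast
  ultimately have "Aut.ord ?G = p"
    using prime_p by (metis prime_nat_iff)
  then show ?thesis
    using Aut.generate_pow_card [OF G_petit_automorphism] by simp
qed

end

section \<open>From the minimum polynomial to an eigenvector\<close>

lemma poly_at_map_eq_sum:
  assumes "degree q < N"
  shows "poly_at_map q \<delta> x = (\<Sum>i<N. coeff q i * (\<delta> ^^ i) x)"
  unfolding poly_at_map_def using assms
  by (intro sum.mono_neutral_left) (auto simp: coeff_eq_0)

lemma degree_monom_diff_monom:
  assumes "1 < p"
  shows "degree (monom 1 p - monom 1 1 :: 'a::ring_1 poly) = p"
proof (rule antisym)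
  show "degree (monom 1 p - monom 1 1 :: 'a poly) \<le> p"
    using assms by (intro degree_le) auto
  show "p \<le> degree (monom 1 p - monom 1 1 :: 'a poly)"
    using assms by (intro le_degree) auto
qed

lemma poly_at_map_artin_schreier:
  assumes "1 < p"
  shows "poly_at_map (monom 1 p - monom 1 1) \<delta> x =
      (\<delta> ^^ p) x - \<delta> (x :: 'a::ring_1)"
proof -
  have "degree (monom 1 p - monom 1 1 :: 'a poly) < Suc p"
    using degree_monom_diff_monom [OF assms, where 'a = 'a] by simp
  then have "poly_at_map (monom 1 p - monom 1 1) \<delta> x =
      (\<Sum>i<Suc p. coeff (monom 1 p - monom 1 1) i * (\<delta> ^^ i) x)"
    by (rule poly_at_map_eq_sum)
  also have "\<dots> = (\<Sum>i<Suc p. (if i = p then (\<delta> ^^ p) x else 0) - (if i =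
      1 then \<delta> x else 0))"
    by (rule sum.cong) (use assms in auto)
  also have "\<dots> = (\<delta> ^^ p) x - \<delta> x"
    using assms by (simp only: sum_subtractf sum.delta finite_lessThan) simp
  finally show ?thesis .
qed

text \<open>The quotient has degree below p and coefficients in \<open>F\<close>, so minimality on
  \<open>C\<close> yields \<open>x\<close> not annihilated by it. Applying \<open>\<delta>\<close>
  minus the identity to the resulting value gives zero by \<open>delta_p\<close>.\<close>

lemma (in char_p_derivation) eigenvector_exists:
  assumes min_poly: "is_minimum_polynomial F C \<delta> (monom 1 p - monom 1 1)"
    and F: "0 \<in> F" "1 \<in> F"
    and delta_p: "\<And>a. (\<delta> ^^ p) a = \<delta> a"
  obtains x where "x \<in> C" "(\<Sum>j=1..<p. (\<delta> ^^ j) x) \<noteq> 0"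
    "\<delta> (\<Sum>j=1..<p. (\<delta> ^^ j) x) = (\<Sum>j=1..<p. (\<delta> ^^ j) x)"
proof -
  \<comment> \<open>The quotient of \<open>t^p - t\<close> by \<open>t - 1\<close>.\<close>
  define q :: "'a poly" where "q = (\<Sum>j=1..<p. monom 1 j)"
  have coeff_q: "coeff q i = (if 1 \<le> i \<and> i < p then 1 else 0)" for i
    unfolding q_def coeff_sum by (simp add: sum.delta)
  have "q \<noteq> 0"
    using coeff_q [of 1] p_gt_1 by auto
  have deg: "degree q < p"
    using p_pos coeff_q by (intro degree_lessI) auto
  have "\<not> degree (monom 1 p - monom 1 1 :: 'a poly) \<le> degree q"
    using deg degree_monom_diff_monom [OF p_gt_1, where 'a = 'a] by simp
  then have "\<not> (\<forall>x\<in>C. poly_at_map q \<delta> x = 0)"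
    using min_poly F \<open>q \<noteq> 0\<close> coeff_q unfolding is_minimum_polynomial_def by auto
  then obtain x where x: "x \<in> C" "poly_at_map q \<delta> x \<noteq> 0" by blast
  have "poly_at_map q \<delta> x = (\<Sum>i<p. coeff q i * (\<delta> ^^ i) x)"
    by (rule poly_at_map_eq_sum [OF deg])
  also have "\<dots> = (\<Sum>j=1..<p. (\<delta> ^^ j) x)"
    by (rule sum.mono_neutral_cong_right) (auto simp: coeff_q)
  finally have sum: "poly_at_map q \<delta> x = (\<Sum>j=1..<p. (\<delta> ^^ j) x)" .
  have "\<delta> (\<Sum>j=1..<p. (\<delta> ^^ j) x) - (\<Sum>j=1..<p. (\<delta> ^^ j) x) =
      (\<Sum>j=1..<p. (\<delta> ^^ Suc j) x - (\<delta> ^^ j) x)"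
    by (simp add: delta_sum sum_subtractf)
  also have "\<dots> = (\<delta> ^^ p) x - (\<delta> ^^ 1) x"
    using p_pos by (subst sum_Suc_diff') auto
  also have "\<dots> = 0" by (simp add: delta_p)
  finally show ?thesis using that [OF x(1)] x(2) sum by simp
qed

theorem theorem20:
  fixes C F :: "'a::division_ring set"
    and \<delta> :: "'a \<Rightarrow> 'a"
    and n p :: nat
    and d :: 'a
    and f :: "'a poly"
  assumes char_p: "CHAR('a) = p" "p > 0"
    and D: "central_division_algebra C n"
    and der: "derivation \<delta>"
    and F: "F = {a \<in> C. \<delta> a = 0}"
    and min_poly_D: "is_minimum_polynomial F UNIV \<delta> (monom 1 p - monom 1 1)"
    and min_poly_C: "is_minimum_polynomial F C \<delta> (monom 1 p - monom 1 1)"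
    and f: "f = monom 1 p - monom 1 1 - [:d:]"
  shows
    "let D\<^sub>t = diff_poly_ring \<delta>;
         K = (ring_of_type_algebra :: 'a ring)\<lparr>carrier := F\<rparr>;
         A = petit_algebra \<delta> f;
         Aut = algebra_Aut K A;
         G = G_petit \<delta> f
     in
       nonassoc_algebra K A \<and>
       ring.dimension D\<^sub>t (n\<^sup>2 * p\<^sup>2) ((\<lambda>a. [:a:]) ` F) (carrier A) \<and>
       (is_division_algebra A \<longleftrightarrow> (\<forall>z. d \<noteq> V_map \<delta> p z - z)) \<and>
       ((\<forall>z. d \<noteq> V_map \<delta> p z - z) \<longleftrightarrow>
          (\<forall>z. [:d:] \<noteq> monom 1 p - [:- z, 1:] [^]\<^bsub>D\<^sub>t\<^esub> p - [:z:])) \<and>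
       (is_associative_algebra A \<longleftrightarrow> d \<in> F) \<and>
       group Aut \<and> G \<in> carrier Aut \<and>
       subgroup (generate Aut {G}) Aut \<and> card (generate Aut {G}) = p \<and>
       (\<forall>a. G [:a:] = [:a:])"
proof -
  interpret char_p_derivation \<delta> p
    by unfold_locales (use char_p der in auto)
  have C: "C = {c. \<forall>x. c * x = x * c}" "subfield C ring_of_type_algebra"
    and dim: "ring.dimension ring_of_type_algebra (n\<^sup>2) C UNIV"
    using D by (auto simp: central_division_algebra_def)
  have delta_p: "(\<delta> ^^ p) a = \<delta> a" for a
    using min_poly_D poly_at_map_artin_schreier [OF p_gt_1, of \<delta> a]
    by (simp add: is_minimum_polynomial_def)
  have "0 \<in> F" "1 \<in> F" by (auto simp: F C(1))
  then obtain x where x: "x \<in> C" "(\<Sum>j=1..<p. (\<delta> ^^ j) x) \<noteq> 0"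
    "\<delta> (\<Sum>j=1..<p. (\<delta> ^^ j) x) = (\<Sum>j=1..<p. (\<delta> ^^ j) x)"
    using eigenvector_exists [OF min_poly_C _ _ delta_p] by blast
  \<comment> \<open>The eigenvector for eigenvalue 1; it is central because \<open>\<delta>\<close>
    preserves the centre.\<close>
  define u where "u = (\<Sum>j=1..<p. (\<delta> ^^ j) x)"
  have u_central: "u * a = a * u" for a
  proof -
    have "(\<delta> ^^ j) x * b = b * (\<delta> ^^ j) x" for j b
    proof (induction j arbitrary: b)
      case (Suc j)
      then show ?case using delta_central [of "(\<delta> ^^ j) x"] by simp
    qed (use x(1) C(1) in simp)
    then show ?thesis by (simp add: u_def sum_distrib_left sum_distrib_right)
  qed
  interpret central_artin_schreier \<delta> p u C F
    by unfold_locales (use delta_p x C(1) F u_central in \<open>simp_all add: u_def\<close>)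
  have f: "f = petit_poly d" by (simp only: f petit_poly_defs)
  have dim_A: "ring.dimension (diff_poly_ring \<delta>) (n\<^sup>2 * p\<^sup>2) const_F {h. degree h < p}"
    by (rule dimension_petit [OF dim C(2)])
  have Aut: "group (algebra_Aut base_field (petit_algebra \<delta> (petit_poly d)))"
    by (rule group_algebra_Aut [OF nonassoc_algebra_petit])
  \<comment> \<open>Conditions (b) and (c) coincide for each z, since t^p - (t-z)^p is the constant
    V_p(z).\<close>
  have "[:d:] = monom 1 p - [:- z, 1:] [^]\<^bsub>diff_poly_ring \<delta>\<^esub> p - [:z:] \<longleftrightarrow> d = V_map \<delta> p z - z" for z
    by (simp add: linear_power_p)
  moreover have "subgroup (generate (algebra_Aut base_field (petit_algebra \<delta> (petit_poly d)))
      {G_petit \<delta> (petit_poly d)}) (algebra_Aut base_field (petit_algebra \<delta> (petit_poly d)))"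
    using G_petit_automorphism by (intro group.generate_is_subgroup [OF Aut]) simp
  moreover have "G_petit \<delta> (petit_poly d) [:a:] = [:a:]" for a
    using p_pos by (simp add: G_petit_eq)
  ultimately show ?thesis
    unfolding Let_def f
    using nonassoc_algebra_petit dim_A is_division_algebra_petit [OF dim_A] is_associative_algebra_petit
      Aut G_petit_automorphism card_generate_G_petit
    by (simp add: petit_algebra_simps)
qed

end
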